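(* Let $X$ be an infinite dimensional complex Banach space and let $T\in L(X)$. Then $T$ is B-Fredholm (respectively, B-Weyl) if and only if $T$ is of Kato type and $0$ is not an interior point of the Fredholm spectrum $\sigma_{\Phi}(T)$ (respectively, of the Weyl spectrum $\sigma_{\mathcal{W}}(T)$).
   Context: $L(Y)$ is the algebra of bounded linear operators on a Banach space $Y$ (finite dimensional or zero spaces allowed for $Y$); $T-\lambda$ means $T-\lambda I$; $N(S)$, $R(S)$ denote kernel and range of $S\in L(Y)$. $S\in L(Y)$ is Fredholm if $\dim N(S)<\infty$ and $\operatorname{codim}R(S)<\infty$, and Weyl if it is Fredholm with $\dim N(S)=\operatorname{codim}R(S)$. $\sigma_\Phi(T)=\{\lambda\in\mathbb{C}:T-\lambda\text{ is not Fredholm}\}$, $\sigma_{\mathcal{W}}(T)=\{\lambda\in\mathbb{C}:T-\lambda\text{ is not Weyl}\}$. $T\in L(X)$ is B-Fredholm (B-Weyl) if there is $n\in\mathbb{N}$ such that $R(T^n)$ is closed and the restriction of $T$ to $R(T^n)$, viewed as an operator in $L(R(T^n))$, is Fredholm (Weyl). $(M,N)\in Red(T)$ means that $M,N$ are closed $T$-invariant subspaces of $X$ with $X=M\oplus N$; $T_M\in L(M)$, $T_N\in L(N)$ are the restrictions of $T$. $S\in L(Y)$ is Kato if $R(S)$ is closed and $N(S)\subset R(S^n)$ for all $n\ge 0$. $T$ is of Kato type if there is $(M,N)\in Red(T)$ such that $T_M$ is Kato and $T_N$ is nilpotent. *)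

theory Defs
  imports "HOL-Analysis.Analysis"
begin

section \<open>Complex Banach spaces\<close>

class complex_normed_vector = real_normed_vector +
  fixes scaleC :: "complex \<Rightarrow> 'a \<Rightarrow> 'a"  (infixr "*\<^sub>C" 75)
  assumes scaleC_add_right: "c *\<^sub>C (x + y) = c *\<^sub>C x + c *\<^sub>C y"
    and scaleC_add_left: "(c + d) *\<^sub>C x = c *\<^sub>C x + d *\<^sub>C x"
    and scaleC_scaleC: "c *\<^sub>C (d *\<^sub>C x) = (c * d) *\<^sub>C x"
    and scaleC_one: "1 *\<^sub>C x = x"
    and scaleR_scaleC: "r *\<^sub>R x = complex_of_real r *\<^sub>C x"
    and norm_scaleC: "norm (c *\<^sub>C x) = cmod c * norm x"

class complex_banach = complex_normed_vector + complete_space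

subclass (in complex_banach) banach ..

global_interpretation cvec: vector_space "scaleC :: complex \<Rightarrow> 'a \<Rightarrow> 'a::complex_normed_vector"
  by unfold_locales
    (rule scaleC_add_right scaleC_add_left scaleC_scaleC scaleC_one)+

definition bounded_clinear :: "('a::complex_normed_vector \<Rightarrow> 'a) \<Rightarrow> bool" where
  "bounded_clinear T \<longleftrightarrow> bounded_linear T \<and> (\<forall>c x. T (c *\<^sub>C x) = c *\<^sub>C T x)"

section \<open>Dimension, direct sums and codimension\<close>

definition fin_cdim :: "'a::complex_normed_vector set \<Rightarrow> bool" where
  "fin_cdim V \<longleftrightarrow> (\<exists>B. finite B \<and> cvec.span B = V)"

definition direct_sum :: "'a::complex_normed_vector set \<Rightarrow> 'a set \<Rightarrow> 'a set \<Rightarrow> bool" where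
  "direct_sum Y M N \<longleftrightarrow> cvec.subspace M \<and> cvec.subspace N \<and> M \<inter> N = {0} \<and>
     Y = {x + y |x y. x \<in> M \<and> y \<in> N}"

text \<open>
  The quotient \<open>Y / R\<close> is not available as a type, so the codimension of \<open>R\<close> in \<open>Y\<close> is taken to be
  the dimension of a (purely algebraic) complement of \<open>R\<close> in \<open>Y\<close>; the choice of the complement is
  immaterial, see \<open>ccodim_eq\<close> below.  As for \<^const>\<open>cvec.dim\<close>, the number is meaningful only
  when it is finite.
\<close>

definition fin_ccodim :: "'a::complex_normed_vector set \<Rightarrow> 'a set \<Rightarrow> bool" where
  "fin_ccodim Y R \<longleftrightarrow> (\<exists>C. direct_sum Y R C \<and> fin_cdim C)"

definition ccodim :: "'a::complex_normed_vector set \<Rightarrow> 'a set \<Rightarrow> nat" where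
  "ccodim Y R = cvec.dim (SOME C. direct_sum Y R C)"

lemma complement_independent_card:
  assumes C: "direct_sum Y R C" and D: "direct_sum Y R D" and fin: "fin_cdim D"
    and B: "B \<subseteq> C" "cvec.independent B"
  shows "finite B \<and> card B \<le> cvec.dim D"
proof -
  have subR: "cvec.subspace R" and subC: "cvec.subspace C" and subD: "cvec.subspace D"
    and RC: "R \<inter> C = {0}"
    using C D by (auto simp: direct_sum_def)
  have "\<exists>d. d \<in> D \<and> c - d \<in> R" if "c \<in> C" for c
  proof -
    have "0 + c \<in> Y"
      using C that cvec.subspace_0[OF subR] unfolding direct_sum_def by blast
    then obtain r d where "c = r + d" "r \<in> R" "d \<in> D"
      using D unfolding direct_sum_def by auto
    then show ?thesis by (intro exI[of _ d]) auto
  qed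
  then obtain p where p: "\<And>c. c \<in> C \<Longrightarrow> p c \<in> D \<and> c - p c \<in> R" by metis
  have key: "u v = 0" if t: "finite t" "t \<subseteq> B" "(\<Sum>v\<in>t. u v *\<^sub>C p v) = 0" "v \<in> t" for t u v
  proof -
    have "(\<Sum>v\<in>t. u v *\<^sub>C (v - p v)) \<in> R"
      using t B p by (intro cvec.subspace_sum[OF subR] cvec.subspace_scale[OF subR]) auto
    moreover have "(\<Sum>v\<in>t. u v *\<^sub>C (v - p v)) = (\<Sum>v\<in>t. u v *\<^sub>C v)"
      using t(3) by (simp add: cvec.scale_right_diff_distrib sum_subtractf)
    moreover have "(\<Sum>v\<in>t. u v *\<^sub>C v) \<in> C"
      using t B by (intro cvec.subspace_sum[OF subC] cvec.subspace_scale[OF subC]) auto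
    ultimately have "(\<Sum>v\<in>t. u v *\<^sub>C v) = 0" using RC by auto
    then show "u v = 0" using cvec.independentD[OF B(2)] t by blast
  qed
  have inj: "inj_on p B"
  proof (rule inj_onI, rule ccontr)
    fix x y assume xy: "x \<in> B" "y \<in> B" "p x = p y" "x \<noteq> y"
    have "(\<Sum>v\<in>{x, y}. (if v = x then 1 else - 1) *\<^sub>C p v) = 0"
      using xy by simp
    from key[OF _ _ this, of x] xy show False by auto
  qed
  have ind: "cvec.independent (p ` B)"
    unfolding cvec.independent_explicit_module
  proof (intro allI impI)
    fix t u v assume t: "finite t" "t \<subseteq> p ` B" "(\<Sum>v\<in>t. u v *\<^sub>C v) = 0" "v \<in> t"
    then obtain s where s: "s \<subseteq> B" "finite s" "t = p ` s" by (meson finite_subset_image)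
    have "inj_on p s" using inj s(1) by (rule inj_on_subset)
    then have "(\<Sum>v\<in>s. u (p v) *\<^sub>C p v) = 0"
      using t(3) s(3) by (simp add: sum.reindex)
    then show "u v = 0" using key[OF s(2,1), of "u \<circ> p"] t(4) s(3) by auto
  qed
  obtain F where F: "finite F" "cvec.span F = D" using fin unfolding fin_cdim_def by blast
  obtain E where E: "E \<subseteq> D" "cvec.independent E" "D \<subseteq> cvec.span E" "card E = cvec.dim D"
    using cvec.basis_exists by blast
  have "finite E" using cvec.independent_span_bound[OF F(1) E(2)] E(1) F(2) by simp
  moreover have "p ` B \<subseteq> cvec.span E" using p B E by auto
  ultimately have "finite (p ` B) \<and> card (p ` B) \<le> card E"
    using cvec.independent_span_bound ind by blast
  then show ?thesis
    using inj E(4) by (simp add: card_image finite_image_iff)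
qed

lemma ccodim_eq:
  assumes D: "direct_sum Y R D" and fin: "fin_cdim D"
  shows "ccodim Y R = cvec.dim D"
proof -
  define C where "C = (SOME C. direct_sum Y R C)"
  have C: "direct_sum Y R C" unfolding C_def using D by (rule someI)
  obtain B where B: "B \<subseteq> C" "cvec.independent B" "C \<subseteq> cvec.span B" "card B = cvec.dim C"
    using cvec.basis_exists by blast
  have fB: "finite B \<and> card B \<le> cvec.dim D"
    by (rule complement_independent_card[OF C D fin B(1,2)])
  have "cvec.span B = C"
    using B C by (auto simp: direct_sum_def intro: cvec.span_minimal[THEN subsetD])
  then have finC: "fin_cdim C" using fB unfolding fin_cdim_def by blast
  obtain E where E: "E \<subseteq> D" "cvec.independent E" "D \<subseteq> cvec.span E" "card E = cvec.dim D"
    using cvec.basis_exists by blast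
  have "card E \<le> cvec.dim C"
    using complement_independent_card[OF D C finC E(1,2)] by blast
  then show ?thesis using fB B(4) E(4) by (simp add: ccodim_def C_def)
qed

section \<open>Fredholm, Weyl and Kato operators on an invariant subspace\<close>

text \<open>
  An operator in \<open>L(Y)\<close>, for a subspace \<open>Y\<close> of the ambient space, is represented by a map \<open>S\<close> of the
  ambient space that leaves \<open>Y\<close> invariant; only the values of \<open>S\<close> on \<open>Y\<close> matter below.  Thus the
  restriction of \<open>T\<close> to \<open>Y\<close> is the pair of \<open>Y\<close> and \<open>T\<close>.
\<close>

definition kernel_on :: "'a::complex_normed_vector set \<Rightarrow> ('a \<Rightarrow> 'a) \<Rightarrow> 'a set" where
  "kernel_on Y S = {x \<in> Y. S x = 0}"

definition fredholm_on :: "'a::complex_normed_vector set \<Rightarrow> ('a \<Rightarrow> 'a) \<Rightarrow> bool" where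
  "fredholm_on Y S \<longleftrightarrow> fin_cdim (kernel_on Y S) \<and> fin_ccodim Y (S ` Y)"

definition weyl_on :: "'a::complex_normed_vector set \<Rightarrow> ('a \<Rightarrow> 'a) \<Rightarrow> bool" where
  "weyl_on Y S \<longleftrightarrow> fredholm_on Y S \<and> cvec.dim (kernel_on Y S) = ccodim Y (S ` Y)"

text \<open>For closed \<open>Y\<close>, being closed in \<open>Y\<close> and being closed in the ambient space agree.\<close>

definition kato_on :: "'a::complex_normed_vector set \<Rightarrow> ('a \<Rightarrow> 'a) \<Rightarrow> bool" where
  "kato_on Y S \<longleftrightarrow> closed (S ` Y) \<and> (\<forall>n. kernel_on Y S \<subseteq> (S ^^ n) ` Y)"

definition nilpotent_on :: "'a::complex_normed_vector set \<Rightarrow> ('a \<Rightarrow> 'a) \<Rightarrow> bool" where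
  "nilpotent_on Y S \<longleftrightarrow> (\<exists>d. \<forall>x\<in>Y. (S ^^ d) x = 0)"

section \<open>Spectra and operator classes\<close>

definition fredholm_spectrum :: "('a::complex_normed_vector \<Rightarrow> 'a) \<Rightarrow> complex set" where
  "fredholm_spectrum T = {z. \<not> fredholm_on UNIV (\<lambda>x. T x - z *\<^sub>C x)}"

definition weyl_spectrum :: "('a::complex_normed_vector \<Rightarrow> 'a) \<Rightarrow> complex set" where
  "weyl_spectrum T = {z. \<not> weyl_on UNIV (\<lambda>x. T x - z *\<^sub>C x)}"

definition B_fredholm :: "('a::complex_normed_vector \<Rightarrow> 'a) \<Rightarrow> bool" where
  "B_fredholm T \<longleftrightarrow> (\<exists>n. closed (range (T ^^ n)) \<and> fredholm_on (range (T ^^ n)) T)"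

definition B_weyl :: "('a::complex_normed_vector \<Rightarrow> 'a) \<Rightarrow> bool" where
  "B_weyl T \<longleftrightarrow> (\<exists>n. closed (range (T ^^ n)) \<and> weyl_on (range (T ^^ n)) T)"

definition Red :: "('a::complex_normed_vector \<Rightarrow> 'a) \<Rightarrow> ('a set \<times> 'a set) set" where
  "Red T = {(M, N). closed M \<and> closed N \<and> T ` M \<subseteq> M \<and> T ` N \<subseteq> N \<and> direct_sum UNIV M N}"

definition kato_type :: "('a::complex_normed_vector \<Rightarrow> 'a) \<Rightarrow> bool" where
  "kato_type T \<longleftrightarrow> (\<exists>(M, N) \<in> Red T. kato_on M T \<and> nilpotent_on N T)"

end

theory Submission
  imports Defs
begin

text \<open>
  If \<open>T\<close> restricted to \<open>Y = R(T\<^sup>d)\<close> is Fredholm and \<open>d\<close> is so large that \<open>E = N(T) \<inter> R(T\<^sup>d)\<close> lies in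
  every \<open>R(T\<^sup>m)\<close>, then over the ring of polynomials in \<open>t\<close> modulo \<open>t\<^sup>d\<close>, with \<open>t\<close> acting as \<open>T\<close>, both
  \<open>N(T\<^sup>d) \<inter> Y\<close> and \<open>Y / T\<^sup>d Y\<close> are free of finite rank. Free modules over this ring are injective and
  projective, so \<open>N(T\<^sup>d) \<inter> Y\<close> has an invariant complement \<open>N\<close> in \<open>N(T\<^sup>d)\<close>, and \<open>N\<close> has an invariant
  complement \<open>M \<supseteq> Y\<close> in the whole space. On \<open>M\<close> the operator is Kato and Fredholm with the index
  of \<open>T\<close> on \<open>Y\<close>, and small shifts of \<open>T\<close> stay Fredholm with that index.

  Conversely, if \<open>T\<close> is Kato on \<open>M\<close>, a kernel vector \<open>x\<^sub>0\<close> lifts to a chain \<open>T x\<^sub>n\<^sub>+\<^sub>1 = x\<^sub>n\<close> of geometric growth,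
  and \<open>\<Sum>n. \<lambda>\<^sup>n x\<^sub>n\<close> is a nearby kernel vector of \<open>T - \<lambda>\<close>. So the kernel and the range of \<open>T\<close> are close to
  those of \<open>T - \<lambda>\<close>, and Fredholmness of \<open>T - \<lambda>\<close> for a small \<open>\<lambda>\<close> passes to \<open>T\<close> by compactness.
\<close>

section \<open>Relative dimension of subspaces\<close>

text \<open>The exponent in the definition of B-Fredholm need not stabilise
  \<open>N(T) \<inter> R(T^n)\<close>; a larger exponent \<open>d\<close> is found by minimising a
  dimension, and the index survives the passage. Stability makes Jordan chains uniform: every vector
  of \<open>E\<close> is \<open>T^(d-1)\<close> of a vector of \<open>N(T^d) \<inter> Y\<close>,
  which is the freeness of that module, and the same fact makes \<open>Y / T^d Y\<close> free. Both
  complements are written out explicitly, as a null space and as a finite-dimensional extension of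
  \<open>Y\<close>, so that closedness can be read off. In the converse the shift is invertible on
  \<open>N\<close> only for nonzero \<lambda>, so the case where \<open>T\<close> itself is good
  stands apart. The compactness argument yields finiteness but no index; the index of
  \<open>T\<close> on \<open>M\<close> is then recovered from a nearby good shift by perturbation.
  Quotients matter only through their dimensions: \<open>rel_dim R Z n\<close> stands for
  \<open>dim Z/R = n\<close>, recorded as a chain of one-vector extensions from \<open>R\<close> to
  \<open>Z\<close>. Equality of indices is written \<open>p' + q = p + q'\<close> to stay within the
  natural numbers.\<close>

inductive rel_dim :: "'a::complex_normed_vector set \<Rightarrow> 'a set \<Rightarrow> nat \<Rightarrow> bool" for R where
  rel_dim_0: "cvec.subspace R \<Longrightarrow> rel_dim R R 0"
| rel_dim_Suc: "rel_dim R Z n \<Longrightarrow> x \<notin> Z \<Longrightarrow> rel_dim R (cvec.span (insert x Z)) (Suc n)"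

lemma mem_adjoin:
  assumes "cvec.subspace Z"
  shows "y \<in> cvec.span (insert x Z) \<longleftrightarrow> (\<exists>k. y - k *\<^sub>C x \<in> Z)"
  using assms by (metis cvec.span_breakdown_eq cvec.span_eq_iff)

lemma rel_dim_subspace_lower: "rel_dim R Z n \<Longrightarrow> cvec.subspace R"
  by (induction rule: rel_dim.induct) auto

lemma rel_dim_subspace_upper: "rel_dim R Z n \<Longrightarrow> cvec.subspace Z"
  by (induction rule: rel_dim.induct) auto

lemma rel_dim_subset: "rel_dim R Z n \<Longrightarrow> R \<subseteq> Z"
  by (induction rule: rel_dim.induct) (auto intro: cvec.span_base)

lemma rel_dim_0_iff: "rel_dim R Z 0 \<longleftrightarrow> cvec.subspace R \<and> Z = R"
  by (auto elim: rel_dim.cases intro: rel_dim_0)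

lemma rel_dim_trans:
  assumes "rel_dim R Z n" "rel_dim Z W m"
  shows "rel_dim R W (n + m)"
  using assms(2,1) by (induction rule: rel_dim.induct) (auto intro: rel_dim_Suc)

lemma rel_dim_one: "cvec.subspace R \<Longrightarrow> x \<notin> R \<Longrightarrow> rel_dim R (cvec.span (insert x R)) 1"
  using rel_dim_Suc[OF rel_dim_0] by simp

lemma adjoin_commute:
  "cvec.span (insert x (cvec.span (insert z Z))) = cvec.span (insert z (cvec.span (insert x Z)))"
proof -
  have "cvec.span (insert x (cvec.span (insert z Z))) = cvec.span (insert x (insert z Z))" for x z
    unfolding cvec.span_eq
    by (auto intro: cvec.span_base cvec.span_mono[THEN subsetD, of "insert z Z"])
  then show ?thesis by (simp add: insert_commute)
qed

text \<open>A vector outside the top of the chain can be adjoined to every member without collapsing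
  a step: by exchange, \<open>z\<close> in the span of \<open>x\<close> and \<open>Z\<close> would
  put \<open>x\<close> into the span of \<open>z\<close> and \<open>Z\<close>.\<close>

lemma rel_dim_adjoin_both:
  assumes "rel_dim R Z n" "x \<notin> Z"
  shows "rel_dim (cvec.span (insert x R)) (cvec.span (insert x Z)) n"
  using assms
proof (induction rule: rel_dim.induct)
  case rel_dim_0
  then show ?case by (intro rel_dim.rel_dim_0) auto
next
  case (rel_dim_Suc Z n z)
  note Z = rel_dim_subspace_upper[OF rel_dim_Suc(1)]
  have x: "x \<notin> Z" using rel_dim_Suc by (auto intro: cvec.span_base)
  have "z \<notin> cvec.span (insert x Z)"
    using rel_dim_Suc.prems rel_dim_Suc.hyps(2) Z cvec.in_span_insert[of z x Z]
    by (auto simp: cvec.span_eq_iff[THEN iffD2])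
  from rel_dim.rel_dim_Suc[OF rel_dim_Suc.IH[OF x] this] show ?case
    by (simp add: adjoin_commute)
qed

text \<open>The chain is rerouted through \<open>x\<close>. At the stage where \<open>x\<close>
  enters, it replaces the vector adjoined there; below this stage \<open>x\<close> is added to every
  member, above it nothing changes.\<close>

lemma rel_dim_adjoin_lower:
  assumes "rel_dim R Z n" "x \<in> Z" "x \<notin> R"
  shows "\<exists>m. n = Suc m \<and> rel_dim (cvec.span (insert x R)) Z m"
  using assms
proof (induction rule: rel_dim.induct)
  case (rel_dim_Suc Z n z)
  note Z = rel_dim_subspace_upper[OF rel_dim_Suc(1)]
  show ?case
  proof (cases "x \<in> Z")
    case True
    then show ?thesis using rel_dim_Suc by (blast intro: rel_dim.rel_dim_Suc)
  next
    case False
    have "z \<in> cvec.span (insert x Z)"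
      using rel_dim_Suc.prems False Z cvec.in_span_insert[of x z Z]
      by (auto simp: cvec.span_eq_iff[THEN iffD2])
    then have "cvec.span (insert z Z) = cvec.span (insert x Z)"
      using rel_dim_Suc.prems by (auto simp: cvec.span_eq intro: cvec.span_base)
    then show ?thesis using rel_dim_adjoin_both[OF rel_dim_Suc.hyps(1) False] by auto
  qed
qed auto

text \<open>The last vector of the first chain can serve as the first vector of both chains;
  absorbing it into \<open>R\<close> shortens both by one.\<close>

lemma rel_dim_unique:
  assumes "rel_dim R Z n" "rel_dim R Z m"
  shows "n = m"
  using assms
proof (induction n arbitrary: m R rule: nat_induct)
  case 0
  then have "Z = R" by (simp add: rel_dim_0_iff)
  with 0(2) show ?case
  proof cases
    case (rel_dim_Suc W k x)
    then show ?thesis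
      using rel_dim_subset[OF rel_dim_Suc(3)] \<open>Z = R\<close> by (auto intro: cvec.span_base)
  qed simp
next
  case (Suc n)
  from Suc.prems(1) obtain W x where W: "rel_dim R W n" "x \<notin> W" "Z = cvec.span (insert x W)"
    by cases auto
  have x: "x \<in> Z" "x \<notin> R" using W rel_dim_subset[OF W(1)] by (auto intro: cvec.span_base)
  show ?case
    using rel_dim_adjoin_lower[OF Suc.prems(1) x] rel_dim_adjoin_lower[OF Suc.prems(2) x] Suc.IH
    by auto
qed

text \<open>Vectors of \<open>V\<close> are adjoined first, as long as the lower end has not reached
  \<open>V\<close>. Besides additivity this gives finiteness of both parts.\<close>

lemma rel_dim_split:
  assumes "rel_dim R W n" "cvec.subspace V" "R \<subseteq> V" "V \<subseteq> W"
  shows "\<exists>m k. rel_dim R V m \<and> rel_dim V W k \<and> m + k = n"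
  using assms
proof (induction n arbitrary: R rule: nat_induct)
  case 0
  then show ?case by (auto simp: rel_dim_0_iff)
next
  case (Suc n)
  show ?case
  proof (cases "V = R")
    case True
    then show ?thesis using Suc.prems by (intro exI[of _ 0] exI[of _ "Suc n"]) (auto simp: rel_dim_0_iff)
  next
    case False
    then obtain x where x: "x \<in> V" "x \<notin> R" using Suc.prems by auto
    have "rel_dim (cvec.span (insert x R)) W n"
      using rel_dim_adjoin_lower[OF Suc.prems(1)] x Suc.prems by auto
    moreover have "cvec.span (insert x R) \<subseteq> V"
      using Suc.prems x by (intro cvec.span_minimal) auto
    ultimately obtain m k where "rel_dim (cvec.span (insert x R)) V m" "rel_dim V W k" "m + k = n"
      using Suc.IH Suc.prems by blast
    then show ?thesis
      using rel_dim_trans[OF rel_dim_one[OF rel_dim_subspace_lower[OF Suc.prems(1)] x(2)]]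
      by (intro exI[of _ "Suc m"] exI[of _ k]) force
  qed
qed

lemma rel_dim_span_finite:
  assumes "finite B" "cvec.subspace R"
  shows "\<exists>n. rel_dim R (cvec.span (R \<union> B)) n"
  using assms
proof (induction B)
  case empty
  then show ?case by (intro exI[of _ 0]) (simp add: rel_dim_0_iff cvec.span_eq_iff[THEN iffD2])
next
  case (insert b B)
  then obtain n where n: "rel_dim R (cvec.span (R \<union> B)) n" by blast
  have eq: "cvec.span (R \<union> insert b B) = cvec.span (insert b (cvec.span (R \<union> B)))"
    unfolding cvec.span_eq
    by (auto intro: cvec.span_base cvec.span_mono[THEN subsetD, of "R \<union> B"])
  show ?case
  proof (cases "b \<in> cvec.span (R \<union> B)")
    case True
    then have "cvec.span (R \<union> insert b B) = cvec.span (R \<union> B)"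
      unfolding eq by (subst insert_absorb) simp_all
    then show ?thesis using n by auto
  next
    case False
    then show ?thesis using rel_dim_Suc[OF n False] eq by auto
  qed
qed

lemma rel_dim_cover:
  assumes "cvec.subspace R" "cvec.subspace Z" "R \<subseteq> Z" "finite B" "Z \<subseteq> cvec.span (R \<union> B)"
  shows "\<exists>n. rel_dim R Z n"
  using rel_dim_span_finite[OF assms(4,1)] rel_dim_split assms(2,3,5) by blast

lemma rel_dim_basis:
  assumes "rel_dim R Z n"
  shows "\<exists>B. finite B \<and> cvec.independent B \<and> card B = n \<and> R \<inter> cvec.span B = {0} \<and>
           Z = cvec.span (R \<union> B)"
  using assms
proof (induction rule: rel_dim.induct)
  case rel_dim_0
  then show ?case
    by (intro exI[of _ "{}"])
      (auto simp: cvec.span_eq_iff[THEN iffD2] cvec.subspace_0 cvec.independent_empty)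
next
  case (rel_dim_Suc Z n x)
  then obtain B where B: "finite B" "cvec.independent B" "card B = n" "R \<inter> cvec.span B = {0}"
    "Z = cvec.span (R \<union> B)" by blast
  have R: "cvec.subspace R" using rel_dim_Suc(1) by (rule rel_dim_subspace_lower)
  have x: "x \<notin> cvec.span B"
    using rel_dim_Suc.hyps(2) B(5) cvec.span_mono[of B "R \<union> B"] by auto
  have "y = 0" if y: "y \<in> R" "y \<in> cvec.span (insert x B)" for y
  proof -
    obtain k where k: "y - k *\<^sub>C x \<in> cvec.span B"
      using y(2) cvec.span_insert by blast
    have "k = 0"
    proof (rule ccontr)
      assume "k \<noteq> 0"
      have "y \<in> Z" "y - k *\<^sub>C x \<in> Z"
        unfolding B(5) using y(1) k cvec.span_mono[of B "R \<union> B"] by (auto intro: cvec.span_base)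
      then have "y - (y - k *\<^sub>C x) \<in> Z" unfolding B(5) by (rule cvec.span_diff)
      then have "k *\<^sub>C x \<in> Z" by simp
      then have "inverse k *\<^sub>C (k *\<^sub>C x) \<in> Z" unfolding B(5) by (rule cvec.span_scale)
      then show False using \<open>k \<noteq> 0\<close> rel_dim_Suc.hyps(2) by simp
    qed
    then show ?thesis using k y B(4) by auto
  qed
  then have "R \<inter> cvec.span (insert x B) = {0}"
    using R by (auto simp: cvec.subspace_0 cvec.span_zero)
  moreover have "cvec.span (insert x Z) = cvec.span (R \<union> insert x B)"
    unfolding cvec.span_eq B(5)
    by (auto intro: cvec.span_base cvec.span_mono[THEN subsetD, of "R \<union> B"])
  moreover have "cvec.independent (insert x B)" using B(2) x by (rule cvec.independent_insertI[rotated])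
  moreover have "x \<notin> B" using x cvec.span_base by blast
  ultimately show ?case using B(1,3) by (intro exI[of _ "insert x B"]) auto
qed

section \<open>Relative dimension versus dimension and codimension\<close>

lemma sum_eq_span_Un:
  assumes "cvec.subspace R" "cvec.subspace C"
  shows "{x + y |x y. x \<in> R \<and> y \<in> C} = cvec.span (R \<union> C)"
  using assms by (simp add: cvec.span_Un cvec.span_eq_iff[THEN iffD2])

lemma span_Un_span: "cvec.span (R \<union> cvec.span B) = cvec.span (R \<union> B)"
  unfolding cvec.span_eq
  by (auto intro: cvec.span_base cvec.span_mono[THEN subsetD, of B "R \<union> B"])

lemma rel_dim_direct_sum:
  assumes "rel_dim R Z n"
  obtains B where "finite B" "cvec.independent B" "card B = n" "direct_sum Z R (cvec.span B)"
proof -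
  from rel_dim_basis[OF assms] obtain B where B: "finite B" "cvec.independent B" "card B = n"
    "R \<inter> cvec.span B = {0}" "Z = cvec.span (R \<union> B)" by blast
  moreover have "direct_sum Z R (cvec.span B)"
    using B rel_dim_subspace_lower[OF assms]
    by (simp add: direct_sum_def sum_eq_span_Un span_Un_span)
  ultimately show ?thesis using that by blast
qed

lemma fin_cdim_iff: "cvec.subspace V \<Longrightarrow> fin_cdim V \<longleftrightarrow> (\<exists>n. rel_dim {0} V n)"
proof
  assume "cvec.subspace V" "fin_cdim V"
  then show "\<exists>n. rel_dim {0} V n"
    unfolding fin_cdim_def using rel_dim_span_finite[of _ "{0}"] by force
next
  assume "\<exists>n. rel_dim {0} V n"
  then obtain n where "rel_dim {0} V n" by blast
  from rel_dim_basis[OF this] obtain B where B: "finite B" "V = cvec.span ({0} \<union> B)" by blast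
  then have "cvec.span B = V" by simp
  with B(1) show "fin_cdim V" unfolding fin_cdim_def by blast
qed

lemma rel_dim_dim: "rel_dim {0} V n \<Longrightarrow> cvec.dim V = n"
  using rel_dim_basis[of "{0}" V n] cvec.dim_span_eq_card_independent by auto

lemma fin_ccodim_iff:
  assumes "cvec.subspace R"
  shows "fin_ccodim Y R \<longleftrightarrow> (\<exists>n. rel_dim R Y n)"
proof
  assume "fin_ccodim Y R"
  then obtain C B where C: "direct_sum Y R C" and B: "finite B" "cvec.span B = C"
    by (auto simp: fin_ccodim_def fin_cdim_def)
  have "Y = cvec.span (R \<union> C)"
    using C sum_eq_span_Un[of R C] unfolding direct_sum_def by metis
  also have "\<dots> = cvec.span (R \<union> B)" using B(2) span_Un_span by metis
  finally show "\<exists>n. rel_dim R Y n" using rel_dim_span_finite[OF B(1) assms] by simp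
next
  assume "\<exists>n. rel_dim R Y n"
  then obtain n where "rel_dim R Y n" by blast
  then show "fin_ccodim Y R"
    by (rule rel_dim_direct_sum) (auto simp: fin_ccodim_def fin_cdim_def)
qed

lemma rel_dim_ccodim:
  assumes "rel_dim R Y n" 
  shows "ccodim Y R = n"
proof -
  obtain B where B: "finite B" "cvec.independent B" "card B = n" "direct_sum Y R (cvec.span B)"
    using rel_dim_direct_sum[OF assms] .
  have "ccodim Y R = cvec.dim (cvec.span B)"
    using B by (intro ccodim_eq) (auto simp: fin_cdim_def)
  then show ?thesis using B(3) cvec.dim_span_eq_card_independent[OF B(2)] by simp
qed

section \<open>Linear maps and relative dimension\<close>

definition clin :: "('a::complex_normed_vector \<Rightarrow> 'a) \<Rightarrow> bool" where
  "clin S \<longleftrightarrow> (\<forall>x y. S (x + y) = S x + S y) \<and> (\<forall>c x. S (c *\<^sub>C x) = c *\<^sub>C S x)"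

lemma clin_add: "clin S \<Longrightarrow> S (x + y) = S x + S y" by (simp add: clin_def)
lemma clin_scale: "clin S \<Longrightarrow> S (c *\<^sub>C x) = c *\<^sub>C S x" by (simp add: clin_def)
lemma clin_0: "clin S \<Longrightarrow> S 0 = 0" using clin_scale[of S 0 0] by simp
lemma clin_diff: "clin S \<Longrightarrow> S (x - y) = S x - S y"
  using clin_add[of S "x - y" y] by (simp add: algebra_simps)

lemma clin_funpow: "clin S \<Longrightarrow> clin (S ^^ n)"
  by (induction n) (auto simp: clin_def)

lemma subspace_clin_image:
  assumes "clin S" "cvec.subspace Y"
  shows "cvec.subspace (S ` Y)"
proof (rule cvec.subspaceI)
  show "0 \<in> S ` Y"
    using clin_0[OF assms(1)] cvec.subspace_0[OF assms(2)] by force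
  fix x y assume "x \<in> S ` Y" "y \<in> S ` Y"
  then show "x + y \<in> S ` Y"
    using cvec.subspace_add[OF assms(2)] by (auto simp: clin_add[OF assms(1), symmetric])
next
  fix c x assume "x \<in> S ` Y"
  then show "c *\<^sub>C x \<in> S ` Y"
    using cvec.subspace_scale[OF assms(2)] by (auto simp: clin_scale[OF assms(1), symmetric])
qed

lemma subspace_kernel_on: "clin S \<Longrightarrow> cvec.subspace Y \<Longrightarrow> cvec.subspace (kernel_on Y S)"
  unfolding cvec.subspace_def kernel_on_def by (auto simp: clin_0 clin_add clin_scale)

lemma clin_image_adjoin:
  assumes "clin S" "cvec.subspace Z"
  shows "S ` cvec.span (insert x Z) = cvec.span (insert (S x) (S ` Z))" (is "?l = ?r")
proof
  show "?l \<subseteq> ?r"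
  proof
    fix y assume "y \<in> ?l"
    then obtain w k where w: "y = S w" "w - k *\<^sub>C x \<in> Z" using mem_adjoin[OF assms(2)] by blast
    then have "y - k *\<^sub>C S x = S (w - k *\<^sub>C x)"
      by (simp add: clin_diff[OF assms(1)] clin_scale[OF assms(1)])
    then show "y \<in> ?r"
      using w(2) mem_adjoin[OF subspace_clin_image[OF assms]] by blast
  qed
  show "?r \<subseteq> ?l"
    using assms by (intro cvec.span_minimal subspace_clin_image) (auto intro: cvec.span_base)
qed

lemma rel_dim_image:
  assumes "clin S" "rel_dim R Z n"
  shows "\<exists>m. rel_dim (S ` R) (S ` Z) m"
  using assms(2)
proof (induction rule: rel_dim.induct)
  case rel_dim_0
  then show ?case using subspace_clin_image[OF assms(1)] by (auto intro: rel_dim.rel_dim_0)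
next
  case (rel_dim_Suc Z n x)
  then obtain m where m: "rel_dim (S ` R) (S ` Z) m" by blast
  note Z = rel_dim_subspace_upper[OF rel_dim_Suc(1)]
  show ?case
  proof (cases "S x \<in> S ` Z")
    case True
    then have "S ` cvec.span (insert x Z) = S ` Z"
      using Z assms(1) by (simp add: clin_image_adjoin insert_absorb subspace_clin_image)
    then show ?thesis using m by auto
  next
    case False
    then show ?thesis using rel_dim.rel_dim_Suc[OF m False] Z assms(1)
      by (auto simp: clin_image_adjoin)
  qed
qed

text \<open>A basis of \<open>Z / R\<close> is pulled back along \<open>f\<close> one vector at a
  time, so \<open>f\<close> is injective on \<open>G\<close> even modulo \<open>R\<close>. With the
  identity as \<open>f\<close> this is an ordinary complement of \<open>R\<close>; with
  \<open>T^d\<close> it supplies the free generators in the Kato decomposition.\<close>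

lemma rel_dim_lift:
  assumes "clin f" "rel_dim R Z n" "Z \<subseteq> range f"
  shows "\<exists>G. rel_dim {0} G n \<and> (\<forall>g\<in>G. f g \<in> R \<longrightarrow> g = 0) \<and>
    Z = {r + f g |r g. r \<in> R \<and> g \<in> G}"
  using assms(2,3)
proof (induction rule: rel_dim.induct)
  case rel_dim_0
  show ?case
    by (intro exI[of _ "{0}"]) (auto simp: clin_0[OF assms(1)] rel_dim_0_iff)
next
  case (rel_dim_Suc Z n z)
  note Z = rel_dim_subspace_upper[OF rel_dim_Suc(1)]
  have R0: "0 \<in> R" using rel_dim_subspace_lower[OF rel_dim_Suc(1)] by (rule cvec.subspace_0)
  have "Z \<subseteq> range f" "z \<in> range f"
    using rel_dim_Suc.prems cvec.span_superset[of "insert z Z"] by auto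
  then obtain G x where G: "rel_dim {0} G n" "\<forall>g\<in>G. f g \<in> R \<longrightarrow> g = 0"
    "Z = {r + f g |r g. r \<in> R \<and> g \<in> G}" and x: "z = f x"
    using rel_dim_Suc.IH by auto
  note sG = rel_dim_subspace_upper[OF G(1)]
  have fG: "f g \<in> Z" if "g \<in> G" for g
  proof -
    have "0 + f g \<in> Z" using G(3) R0 that by blast
    then show ?thesis by simp
  qed
  have xG: "x \<notin> G" using fG x rel_dim_Suc.hyps(2) by auto
  have "g = 0" if g: "g \<in> cvec.span (insert x G)" "f g \<in> R" for g
  proof -
    obtain k where k: "g - k *\<^sub>C x \<in> G" using g(1) mem_adjoin[OF sG] by blast
    have "f g - f (g - k *\<^sub>C x) \<in> Z"
      using fG[OF k] g(2) rel_dim_subset[OF rel_dim_Suc(1)] Z by (blast intro: cvec.subspace_diff)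
    then have "k *\<^sub>C z \<in> Z" using x by (simp add: clin_diff[OF assms(1)] clin_scale[OF assms(1)])
    then have "k = 0"
      using rel_dim_Suc.hyps(2) cvec.subspace_scale[OF Z, of "k *\<^sub>C z" "inverse k"]
      by (cases "k = 0") auto
    then show ?thesis using k g(2) G(2) by auto
  qed
  moreover have "cvec.span (insert z Z) = {r + f g |r g. r \<in> R \<and> g \<in> cvec.span (insert x G)}"
    (is "?l = ?r")
  proof
    show "?l \<subseteq> ?r"
    proof
      fix y assume "y \<in> ?l"
      then obtain k where "y - k *\<^sub>C z \<in> Z" using mem_adjoin[OF Z] by blast
      then obtain r g where "y - k *\<^sub>C z = r + f g" "r \<in> R" "g \<in> G" using G(3) by auto
      then have "y = r + f (g + k *\<^sub>C x)" "r \<in> R" "g + k *\<^sub>C x \<in> cvec.span (insert x G)"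
        using sG by (auto simp: mem_adjoin x clin_add[OF assms(1)] clin_scale[OF assms(1)] algebra_simps
            intro!: exI[of _ k])
      then show "y \<in> ?r" by blast
    qed
    show "?r \<subseteq> ?l"
    proof
      fix y assume "y \<in> ?r"
      then obtain r g k where *: "y = r + f g" "r \<in> R" "g - k *\<^sub>C x \<in> G"
        using mem_adjoin[OF sG] by blast
      then have "y - k *\<^sub>C z = r + f (g - k *\<^sub>C x)"
        by (simp add: x clin_diff[OF assms(1)] clin_scale[OF assms(1)])
      then have "y - k *\<^sub>C z \<in> Z" using * G(3) by blast
      then show "y \<in> ?l" using mem_adjoin[OF Z] by blast
    qed
  qed
  ultimately show ?case
    using rel_dim.rel_dim_Suc[OF G(1) xG] by blast
qed

text \<open>Finiteness comes from a finite spanning set of \<open>G\<close>; the number is then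
  identified through the codimension, for which \<open>G\<close> is an admissible
  complement.\<close>

lemma rel_dim_sum:
  assumes "rel_dim {0} G n" "cvec.subspace R" "R \<inter> G = {0}"
  shows "rel_dim R (cvec.span (R \<union> G)) n"
proof -
  obtain B where B: "finite B" "cvec.independent B" "card B = n" "G = cvec.span B"
    using rel_dim_basis[OF assms(1)] by auto
  obtain m where m: "rel_dim R (cvec.span (R \<union> G)) m"
    using rel_dim_span_finite[OF B(1) assms(2)] by (auto simp: B(4) span_Un_span)
  have ds: "direct_sum (cvec.span (R \<union> G)) R G"
    unfolding direct_sum_def using assms rel_dim_subspace_upper[OF assms(1)]
    by (simp add: sum_eq_span_Un)
  have "ccodim (cvec.span (R \<union> G)) R = cvec.dim G"
    using B by (intro ccodim_eq[OF ds]) (auto simp: fin_cdim_def)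
  then have "m = n" using rel_dim_ccodim[OF m] rel_dim_dim[OF assms(1)] by simp
  then show ?thesis using m by simp
qed

section \<open>Hahn-Banach and finite-dimensional subspaces\<close>

text \<open>Homogeneity is asked only as an inequality, which is what infimum constructions deliver;
  using it for \<open>1 / t\<close> as well turns it into an equality.\<close>

definition sublinear :: "('a::real_vector \<Rightarrow> real) \<Rightarrow> bool" where
  "sublinear p \<longleftrightarrow> (\<forall>x y. p (x + y) \<le> p x + p y) \<and> (\<forall>t>0. \<forall>x. p (t *\<^sub>R x) \<le> t * p x) \<and> p 0 = 0"

lemma sublinear_add: "sublinear p \<Longrightarrow> p (x + y) \<le> p x + p y"
  and sublinear_0: "sublinear p \<Longrightarrow> p 0 = 0"
  by (auto simp: sublinear_def)

lemma sublinear_scale: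
  assumes "sublinear p" "t \<ge> 0"
  shows "p (t *\<^sub>R x) = t * p x"
proof (cases "t = 0")
  case True
  then show ?thesis using assms by (simp add: sublinear_def)
next
  case False
  then have t: "t > 0" using assms by simp
  have "p ((1 / t) *\<^sub>R t *\<^sub>R x) \<le> (1 / t) * p (t *\<^sub>R x)"
    using assms(1) t unfolding sublinear_def by (metis zero_less_divide_1_iff)
  then have "t * p x \<le> p (t *\<^sub>R x)" using t by (simp add: field_simps)
  then show ?thesis using assms(1) t unfolding sublinear_def by (metis antisym)
qed

lemma sublinear_minus: "sublinear p \<Longrightarrow> - p (- x) \<le> p x"
  using sublinear_add[of p x "- x"] sublinear_0[of p] by simp

text \<open>The infimum over \<open>t \<ge> 0\<close> of \<open>q (x + t y) - t q y\<close> is the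
  classical auxiliary functional: \<open>t = 0\<close> puts it below \<open>q\<close>, and
  \<open>t = 1\<close> at \<open>- y\<close> gives the last bound.\<close>

lemma sublinear_shave:
  assumes q: "sublinear q"
  obtains q' where "sublinear q'" "\<And>x. q' x \<le> q x" "q' (- y) \<le> - q y"
proof -
  define A where "A x = (\<lambda>t. q (x + t *\<^sub>R y) - t * q y) ` {0..}" for x
  define q' where "q' x = Inf (A x)" for x
  \<comment> \<open>Subadditivity applied to \<open>t y = (x + t y) - x\<close> keeps the infimum
    finite.\<close>
  have low: "- q (- x) \<le> a" if "a \<in> A x" for a x
  proof -
    obtain t where t: "t \<ge> 0" "a = q (x + t *\<^sub>R y) - t * q y"
      using \<open>a \<in> A x\<close> by (auto simp: A_def)
    show ?thesis
      using sublinear_add[OF q, of "x + t *\<^sub>R y" "- x"] sublinear_scale[OF q t(1), of y] t(2) by simp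
  qed
  have bdd: "bdd_below (A x)" for x using low by (rule bdd_belowI)
  have ne: "A x \<noteq> {}" for x by (auto simp: A_def)
  have upper: "q' x \<le> q (x + t *\<^sub>R y) - t * q y" if "t \<ge> 0" for x t
    unfolding q'_def using that by (intro cInf_lower bdd) (auto simp: A_def)
  have greatest: "z \<le> q' x" if "\<And>t. t \<ge> 0 \<Longrightarrow> z \<le> q (x + t *\<^sub>R y) - t * q y" for x z
    unfolding q'_def using that by (intro cInf_greatest ne) (auto simp: A_def)
  have "q' (x1 + x2) \<le> q' x1 + q' x2" for x1 x2
  proof -
    have "q' (x1 + x2) - q' x2 \<le> q' x1"
    proof (rule greatest)
      fix t1 :: real assume t1: "t1 \<ge> 0"
      have "q' (x1 + x2) - (q (x1 + t1 *\<^sub>R y) - t1 * q y) \<le> q' x2"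
      proof (rule greatest)
        fix t2 :: real assume t2: "t2 \<ge> 0"
        show "q' (x1 + x2) - (q (x1 + t1 *\<^sub>R y) - t1 * q y) \<le> q (x2 + t2 *\<^sub>R y) - t2 * q y"
          using upper[of "t1 + t2" "x1 + x2"] t1 t2
            sublinear_add[OF q, of "x1 + t1 *\<^sub>R y" "x2 + t2 *\<^sub>R y"]
          by (simp add: algebra_simps)
      qed
      then show "q' (x1 + x2) - q' x2 \<le> q (x1 + t1 *\<^sub>R y) - t1 * q y" by simp
    qed
    then show ?thesis by simp
  qed
  moreover have "q' (s *\<^sub>R x) \<le> s * q' x" if s: "s > 0" for s x
  proof -
    have "q' (s *\<^sub>R x) / s \<le> q' x"
    proof (rule greatest)
      fix t :: real assume t: "t \<ge> 0"
      have "q (s *\<^sub>R x + (s * t) *\<^sub>R y) = s * q (x + t *\<^sub>R y)"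
        using sublinear_scale[OF q, of s "x + t *\<^sub>R y"] s by (simp add: scaleR_right_distrib)
      then show "q' (s *\<^sub>R x) / s \<le> q (x + t *\<^sub>R y) - t * q y"
        using upper[of "s * t" "s *\<^sub>R x"] s t by (simp add: field_simps)
    qed
    then show ?thesis using s by (simp add: field_simps)
  qed
  moreover have "q' 0 = 0"
  proof (rule antisym)
    show "q' 0 \<le> 0" using upper[of 0 0] sublinear_0[OF q] by simp
    show "0 \<le> q' 0" by (rule greatest) (simp add: sublinear_scale[OF q])
  qed
  ultimately have "sublinear q'" by (simp add: sublinear_def)
  moreover have "q' x \<le> q x" for x using upper[of 0 x] by simp
  moreover have "q' (- y) \<le> - q y" using upper[of 1 "- y"] sublinear_0[OF q] by simp
  ultimately show ?thesis by (rule that)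
qed

text \<open>A minimal sublinear functional cannot be shaved any further and is therefore linear.\<close>

lemma sublinear_dominates_linear:
  assumes p: "sublinear p"
  obtains g where "linear g" "\<And>x. g x \<le> p x"
proof -
  define A where "A = {q. sublinear q \<and> q \<le> p}"
  \<comment> \<open>The order is reversed, so that the maximal element supplied by Zorn is a minimal
    functional.\<close>
  have po: "partial_order_on A (relation_of (\<lambda>q q'. q' \<le> q) A)"
    by (rule partial_order_on_relation_ofI) auto
  have low: "- p (- x) \<le> q x" if "q \<in> A" for q x
  proof -
    have "- p (- x) \<le> - q (- x)" using that by (simp add: A_def le_funD)
    also have "\<dots> \<le> q x" using that by (simp add: A_def sublinear_minus)
    finally show ?thesis .
  qed
  have "\<exists>m\<in>A. \<forall>a\<in>A. a \<le> m \<longrightarrow> a = m"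
  proof (rule predicate_Zorn[OF po])
    fix C assume C: "C \<in> Chains (relation_of (\<lambda>q q'. q' \<le> q) A)"
    have CA: "C \<subseteq> A" using C by (auto simp: Chains_def relation_of_def)
    have tot: "q \<le> q' \<or> q' \<le> q" if "q \<in> C" "q' \<in> C" for q q'
      using C that by (auto simp: Chains_def relation_of_def)
    show "\<exists>u\<in>A. \<forall>a\<in>C. u \<le> a"
    proof (cases "C = {}")
      case True
      then show ?thesis using p by (auto simp: A_def)
    next
      case False
      define u where "u x = Inf ((\<lambda>q. q x) ` C)" for x
      have bdd: "bdd_below ((\<lambda>q. q x) ` C)" for x
        using low CA by (intro bdd_belowI[of _ "- p (- x)"]) auto
      have upper: "u x \<le> q x" if "q \<in> C" for q x
        unfolding u_def using that bdd by (intro cInf_lower) auto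
      have greatest: "z \<le> u x" if "\<And>q. q \<in> C \<Longrightarrow> z \<le> q x" for x z
        unfolding u_def using that False by (intro cInf_greatest) auto
      \<comment> \<open>Of two members of the chain the smaller lies below both, so a single
        sublinear \<open>q\<close> serves for both arguments.\<close>
      have key: "u (x + y) \<le> q1 x + q2 y" if q: "q1 \<in> C" "q2 \<in> C" for q1 q2 x y
      proof -
        obtain q where q': "q \<in> C" "q \<le> q1" "q \<le> q2" using tot[OF q] q by blast
        have "u (x + y) \<le> q x + q y"
          using upper[OF q'(1), of "x + y"] sublinear_add[of q x y] q'(1) CA by (auto simp: A_def)
        then show ?thesis using le_funD[OF q'(2), of x] le_funD[OF q'(3), of y] by simp
      qed
      have "u (x + y) \<le> u x + u y" for x y
      proof -
        have "u (x + y) - u y \<le> u x"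
        proof (rule greatest)
          fix q1 assume q1: "q1 \<in> C"
          have "u (x + y) - q1 x \<le> u y"
            using key[OF q1] by (intro greatest) (simp add: algebra_simps)
          then show "u (x + y) - u y \<le> q1 x" by simp
        qed
        then show ?thesis by simp
      qed
      moreover have "u (t *\<^sub>R x) \<le> t * u x" if t: "t > 0" for t x
      proof -
        have "u (t *\<^sub>R x) / t \<le> u x"
        proof (rule greatest)
          fix q assume q: "q \<in> C"
          then have "q (t *\<^sub>R x) = t * q x" using CA t sublinear_scale[of q t x] by (auto simp: A_def)
          then show "u (t *\<^sub>R x) / t \<le> q x" using upper[OF q, of "t *\<^sub>R x"] t by (simp add: field_simps)
        qed
        then show ?thesis using t by (simp add: field_simps)
      qed
      moreover have "u 0 = 0"
      proof (rule antisym)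
        obtain q where "q \<in> C" using False by auto
        then show "u 0 \<le> 0" using upper[of q 0] CA sublinear_0[of q] by (auto simp: A_def)
        show "0 \<le> u 0" using CA by (intro greatest) (auto simp: A_def sublinear_0)
      qed
      ultimately have "sublinear u" by (simp add: sublinear_def)
      moreover have "u \<le> p"
      proof -
        obtain q where q: "q \<in> C" using False by auto
        then have "u \<le> q" using upper by (simp add: le_funI)
        also have "q \<le> p" using q CA by (auto simp: A_def)
        finally show ?thesis .
      qed
      ultimately show ?thesis using upper by (intro bexI[of _ u]) (auto simp: A_def le_fun_def)
    qed
  qed
  then obtain m where m: "m \<in> A" "\<And>a. a \<in> A \<Longrightarrow> a \<le> m \<Longrightarrow> a = m" by blast
  then have sm: "sublinear m" by (simp add: A_def)
  have neg: "m (- y) = - m y" for y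
  proof (rule antisym)
    obtain q' where q': "sublinear q'" "\<And>x. q' x \<le> m x" "q' (- y) \<le> - m y"
      using sublinear_shave[OF sm, of y] by blast
    then have "q' \<le> m" by (simp add: le_funI)
    moreover have "m \<le> p" using m(1) by (simp add: A_def)
    ultimately have "q' = m" using m(2)[of q'] q'(1) by (auto simp: A_def)
    then show "m (- y) \<le> - m y" using q' by simp
    show "- m y \<le> m (- y)" using sublinear_minus[OF sm, of y] by simp
  qed
  have "linear m"
  proof (rule linearI)
    fix x y
    have "m (- x + - y) \<le> m (- x) + m (- y)" by (rule sublinear_add[OF sm])
    then have "m x + m y \<le> m (x + y)" using neg[of "x + y"] by (simp add: neg)
    then show "m (x + y) = m x + m y" using sublinear_add[OF sm, of x y] by simp
  next
    fix r x
    show "m (r *\<^sub>R x) = r *\<^sub>R m x"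
    proof (cases "r \<ge> 0")
      case True
      then show ?thesis by (simp add: sublinear_scale[OF sm])
    next
      case False
      then have "m ((- r) *\<^sub>R x) = (- r) * m x" by (intro sublinear_scale[OF sm]) simp
      then show ?thesis using neg[of "r *\<^sub>R x"] by simp
    qed
  qed
  moreover have "m x \<le> p x" for x using m(1) by (simp add: A_def le_fun_def)
  ultimately show ?thesis by (rule that)
qed

text \<open>Shaving \<open>p\<close> in the direction \<open>x0\<close> beforehand forces every
  linear minorant to take the value \<open>p x0\<close> at \<open>x0\<close>; no extension from a
  subspace is needed.\<close>

lemma hahn_banach_sublinear:
  assumes "sublinear p"
  obtains g where "linear g" "\<And>x. g x \<le> p x" "g x0 = p x0"
proof -
  obtain p' where p': "sublinear p'" "\<And>x. p' x \<le> p x" "p' (- x0) \<le> - p x0"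
    using sublinear_shave[OF assms, of x0] by blast
  obtain g where g: "linear g" "\<And>x. g x \<le> p' x" using sublinear_dominates_linear[OF p'(1)] by blast
  have "g (- x0) \<le> - p x0" using g(2) p'(3) order_trans by blast
  then have "p x0 \<le> g x0" by (simp add: linear_neg[OF g(1)])
  moreover have le: "g x \<le> p x" for x using g(2) p'(2) order_trans by blast
  ultimately have "g x0 = p x0" by (simp add: antisym)
  with g(1) le show ?thesis by (rule that)
qed

section \<open>Functionals separating a point from a closed subspace\<close>

lemma infdist_less_obtain:
  assumes "infdist x V < e" "V \<noteq> {}"
  obtains v where "v \<in> V" "dist x v < e"
  using assms by (auto simp: infdist_notempty cINF_less_iff)

lemma sublinear_infdist:
  fixes V :: "'a::complex_normed_vector set"
  assumes "cvec.subspace V"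
  shows "sublinear (\<lambda>x. infdist x V)"
  unfolding sublinear_def
proof (intro conjI allI impI)
  note V = cvec.subspace_0[OF assms]
  then have ne: "V \<noteq> {}" by auto
  show "infdist 0 V = 0" using V by simp
  fix x y :: 'a
  show "infdist (x + y) V \<le> infdist x V + infdist y V"
  proof (rule field_le_epsilon)
    fix e :: real assume e: "e > 0"
    obtain v where v: "v \<in> V" "dist x v < infdist x V + e / 2"
      using infdist_less_obtain[OF _ ne] e by (metis less_add_same_cancel1 half_gt_zero)
    obtain w where w: "w \<in> V" "dist y w < infdist y V + e / 2"
      using infdist_less_obtain[OF _ ne] e by (metis less_add_same_cancel1 half_gt_zero)
    have "infdist (x + y) V \<le> dist (x + y) (v + w)"
      using v w assms by (intro infdist_le cvec.subspace_add) auto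
    also have "\<dots> \<le> dist x v + dist y w" by (rule dist_triangle_add)
    finally show "infdist (x + y) V \<le> infdist x V + infdist y V + e" using v w by simp
  qed
next
  note V = cvec.subspace_0[OF assms]
  then have ne: "V \<noteq> {}" by auto
  fix t :: real and x :: 'a assume t: "t > 0"
  show "infdist (t *\<^sub>R x) V \<le> t * infdist x V"
  proof (rule field_le_epsilon)
    fix e :: real assume e: "e > 0"
    obtain v where v: "v \<in> V" "dist x v < infdist x V + e / t"
      using infdist_less_obtain[OF _ ne] e t by (metis less_add_same_cancel1 divide_pos_pos)
    have "infdist (t *\<^sub>R x) V \<le> dist (t *\<^sub>R x) (t *\<^sub>R v)"
      using v assms by (intro infdist_le) (simp add: scaleR_scaleC cvec.subspace_scale)
    also have "\<dots> = t * dist x v" using t by (simp add: dist_norm scaleR_diff_right[symmetric])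
    also have "\<dots> \<le> t * (infdist x V + e / t)" using v t by (intro mult_left_mono) auto
    finally show "infdist (t *\<^sub>R x) V \<le> t * infdist x V + e" using t by (simp add: distrib_left)
  qed
qed

definition cfunctional :: "('a::complex_normed_vector \<Rightarrow> complex) \<Rightarrow> bool" where
  "cfunctional f \<longleftrightarrow> bounded_linear f \<and> (\<forall>c x. f (c *\<^sub>C x) = c * f x)"

text \<open>The distance from \<open>V\<close> is sublinear, zero on \<open>V\<close>, at most the
  norm, and positive at \<open>x0\<close>. A linear minorant that agrees with it at
  \<open>x0\<close> therefore vanishes on \<open>V\<close>, is bounded and is nonzero at
  \<open>x0\<close>; it remains to pass to complex scalars and to normalise.\<close>

lemma cfunctional_separating:
  fixes V :: "'a::complex_normed_vector set"
  assumes V: "cvec.subspace V" "closed V" and x0: "x0 \<notin> V"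
  obtains f where "cfunctional f" "\<And>v. v \<in> V \<Longrightarrow> f v = 0" "f x0 = 1"
proof -
  have V0: "0 \<in> V" using V(1) by (rule cvec.subspace_0)
  obtain g where g: "linear g" "\<And>x. g x \<le> infdist x V" "g x0 = infdist x0 V"
    using hahn_banach_sublinear[OF sublinear_infdist[OF V(1)], of x0] by blast
  have gn: "\<bar>g x\<bar> \<le> norm x" for x
  proof -
    have "infdist x V \<le> norm x" "infdist (- x) V \<le> norm x"
      using infdist_le[OF V0, of x] infdist_le[OF V0, of "- x"] by auto
    then show ?thesis using g(2)[of x] g(2)[of "- x"] by (simp add: linear_neg[OF g(1)] abs_le_iff)
  qed
  have gV: "g v = 0" if "v \<in> V" for v
    using g(2)[of v] g(2)[of "- v"] that V(1)
    by (simp add: linear_neg[OF g(1)] cvec.subspace_neg)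
  \<comment> \<open>The complex linear functional with real part \<open>g\<close> is
    \<open>g x - i g (i x)\<close>.\<close>
  define f where "f x = Complex (g x) (- g (\<i> *\<^sub>C x))" for x
  have fc: "f (c *\<^sub>C x) = c * f x" for c x
  proof -
    have 1: "c *\<^sub>C x = Re c *\<^sub>R x + Im c *\<^sub>R (\<i> *\<^sub>C x)" for c x
      by (simp add: scaleR_scaleC cvec.scale_left_distrib[symmetric] complex_eq mult.commute)
    have 2: "\<i> *\<^sub>C c *\<^sub>C x = Re c *\<^sub>R (\<i> *\<^sub>C x) - Im c *\<^sub>R x"
      using 1[of "\<i> * c" x] by simp
    have "g (c *\<^sub>C x) = Re c * g x + Im c * g (\<i> *\<^sub>C x)"
      by (subst 1) (simp add: linear_add[OF g(1)] linear_scale[OF g(1)])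
    moreover have "g (\<i> *\<^sub>C c *\<^sub>C x) = Re c * g (\<i> *\<^sub>C x) - Im c * g x"
      by (subst 2) (simp add: linear_diff[OF g(1)] linear_scale[OF g(1)])
    ultimately show ?thesis by (simp add: f_def complex_eq_iff)
  qed
  have "bounded_linear f"
  proof (rule bounded_linear_intro[of _ 2])
    fix x y show "f (x + y) = f x + f y"
      by (simp add: f_def complex_eq_iff linear_add[OF g(1)] cvec.scale_right_distrib)
  next
    fix r x show "f (r *\<^sub>R x) = r *\<^sub>R f x" by (simp add: scaleR_scaleC fc scaleR_conv_of_real)
  next
    fix x
    have "cmod (f x) \<le> \<bar>g x\<bar> + \<bar>g (\<i> *\<^sub>C x)\<bar>"
      using cmod_le[of "f x"] by (simp add: f_def)
    also have "\<dots> \<le> norm x + norm x"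
      using gn[of x] gn[of "\<i> *\<^sub>C x"] by (simp add: norm_scaleC)
    finally show "cmod (f x) \<le> norm x * 2" by simp
  qed
  have fx0: "f x0 \<noteq> 0"
  proof -
    have "infdist x0 V > 0" using infdist_pos_not_in_closed[OF V(2) _ x0] V0 by blast
    then show ?thesis using g(3) by (auto simp: f_def complex_eq_iff)
  qed
  have "cfunctional (\<lambda>x. f x / f x0)"
    unfolding cfunctional_def
    using bounded_linear_compose[OF bounded_linear_divide[of "f x0"] \<open>bounded_linear f\<close>] fc
    by auto
  moreover have "f v / f x0 = 0" if "v \<in> V" for v
    using gV[OF that] gV[OF cvec.subspace_scale[OF V(1) that]] by (simp add: f_def Complex_eq_0)
  ultimately show ?thesis using that fx0 by force
qed

section \<open>Finite-dimensional extensions: closedness, projections, compactness\<close>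

lemma bounded_linear_scaleC_left: "bounded_linear (\<lambda>c. c *\<^sub>C (x::'a::complex_normed_vector))"
  by (rule bounded_linear_intro[of _ "norm x"])
    (auto simp: norm_scaleC cvec.scale_left_distrib scaleR_scaleC scaleR_conv_of_real)

lemma bounded_linear_scaleC_right: "bounded_linear (\<lambda>x::'a::complex_normed_vector. c *\<^sub>C x)"
  by (rule bounded_linear_intro[of _ "cmod c"])
    (auto simp: norm_scaleC cvec.scale_right_distrib scaleR_scaleC mult.commute)

lemma cfunctional_clin:
  assumes "cfunctional f"
  shows "f (x + y) = f x + f y" "f (x - y) = f x - f y" "f (c *\<^sub>C x) = c * f x"
  using assms
  by (auto simp: cfunctional_def linear_add linear_diff dest: bounded_linear.linear)

text \<open>With \<open>f\<close> vanishing on \<open>V\<close> and \<open>f x = 1\<close>, the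
  extended subspace is the preimage of \<open>V\<close> under the continuous map
  \<open>y \<mapsto> y - f(y) x\<close>.\<close>

lemma closed_adjoin:
  fixes V :: "'a::complex_normed_vector set"
  assumes V: "cvec.subspace V" "closed V" and x: "x \<notin> V"
  shows "closed (cvec.span (insert x V))"
proof -
  obtain f where f: "cfunctional f" "\<And>v. v \<in> V \<Longrightarrow> f v = 0" "f x = 1"
    using cfunctional_separating[OF V x] by blast
  then have bl: "bounded_linear f" by (simp add: cfunctional_def)
  have "f (y - k *\<^sub>C x) = f y - k" for y k
    using f(3) by (simp add: cfunctional_clin[OF f(1)])
  then have "cvec.span (insert x V) = (\<lambda>y. y - f y *\<^sub>C x) -` V"
    using f(2) by (auto simp: mem_adjoin[OF V(1)]) (metis eq_iff_diff_eq_0)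
  moreover have "bounded_linear (\<lambda>y. y - f y *\<^sub>C x)"
    by (intro bounded_linear_sub bounded_linear_ident
        bounded_linear_compose[OF bounded_linear_scaleC_left bl])
  ultimately show ?thesis
    using V(2) by (simp add: continuous_closed_vimage linear_continuous_at)
qed

lemma closed_rel_dim:
  assumes "rel_dim R Z n" "closed R"
  shows "closed Z"
  using assms by (induction rule: rel_dim.induct) (auto intro: closed_adjoin rel_dim_subspace_upper)

lemma bounded_clinear_clin: "bounded_clinear S \<Longrightarrow> clin S"
  by (auto simp: bounded_clinear_def clin_def linear_add dest: bounded_linear.linear)

lemma bounded_clinear_bounded_linear: "bounded_clinear S \<Longrightarrow> bounded_linear S"
  by (simp add: bounded_clinear_def)

text \<open>One dimension at a time: \<open>f\<close> reads off the coefficient of \<open>x\<close>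
  and vanishes on \<open>E\<close>, and the remainder \<open>y - f(y) x\<close> is sent through the
  projection already built.\<close>

lemma finite_dim_projection:
  fixes E :: "'a::complex_normed_vector set"
  assumes "rel_dim {0} E n"
  shows "\<exists>P. bounded_clinear P \<and> range P \<subseteq> E \<and> (\<forall>x\<in>E. P x = x)"
  using assms
proof (induction rule: rel_dim.induct)
  case rel_dim_0
  then show ?case
    by (intro exI[of _ "\<lambda>x. 0"]) (auto simp: bounded_clinear_def)
next
  case (rel_dim_Suc E n x)
  then obtain P where P: "bounded_clinear P" "range P \<subseteq> E" "\<forall>x\<in>E. P x = x" by blast
  note E = rel_dim_subspace_upper[OF rel_dim_Suc(1)] closed_rel_dim[OF rel_dim_Suc(1) closed_singleton]
  obtain f where f: "cfunctional f" "\<And>v. v \<in> E \<Longrightarrow> f v = 0" "f x = 1"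
    using cfunctional_separating[OF E rel_dim_Suc(2)] by blast
  have bl: "bounded_linear f" using f(1) by (simp add: cfunctional_def)
  define Q where "Q y = P (y - f y *\<^sub>C x) + f y *\<^sub>C x" for y
  have "bounded_linear Q"
    unfolding Q_def
    by (intro bounded_linear_add bounded_linear_sub bounded_linear_ident
        bounded_linear_compose[OF bounded_clinear_bounded_linear[OF P(1)]]
        bounded_linear_compose[OF bounded_linear_scaleC_left bl])
  moreover have "Q (c *\<^sub>C y) = c *\<^sub>C Q y" for c y
    unfolding Q_def clin_diff[OF bounded_clinear_clin[OF P(1)]]
      clin_scale[OF bounded_clinear_clin[OF P(1)]] cfunctional_clin(3)[OF f(1)]
      cvec.scale_right_distrib cvec.scale_right_diff_distrib by simp
  moreover have "Q y \<in> cvec.span (insert x E)" for y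
  proof -
    have "Q y - f y *\<^sub>C x \<in> E" using P(2) unfolding Q_def by auto
    then show ?thesis using mem_adjoin[OF E(1), of "Q y" x] by blast
  qed
  moreover have "Q y = y" if y: "y \<in> cvec.span (insert x E)" for y
  proof -
    obtain k where k: "y - k *\<^sub>C x \<in> E" using y mem_adjoin[OF E(1), of y x] by blast
    have "f y - k * f x = 0"
      using f(2)[OF k] unfolding cfunctional_clin(2,3)[OF f(1)] .
    then have "f y = k" using f(3) by simp
    then show ?thesis using k P(3) by (simp add: Q_def)
  qed
  ultimately have "bounded_clinear Q \<and> range Q \<subseteq> cvec.span (insert x E) \<and>
      (\<forall>y\<in>cvec.span (insert x E). Q y = y)"
    unfolding bounded_clinear_def by blast
  then show ?case by blast
qed

text \<open>A functional bounds the coefficient of the last adjoined vector, so the bounded part of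
  the larger space is a closed subset of a continuous image of a product of compact sets.\<close>

lemma finite_dim_compact:
  fixes E :: "'a::complex_normed_vector set"
  assumes "rel_dim {0} E n"
  shows "compact (E \<inter> cball 0 C)"
  using assms
proof (induction arbitrary: C rule: rel_dim.induct)
  case (rel_dim_Suc E n x)
  note E = rel_dim_subspace_upper[OF rel_dim_Suc(1)] closed_rel_dim[OF rel_dim_Suc(1) closed_singleton]
  obtain f where f: "cfunctional f" "\<And>v. v \<in> E \<Longrightarrow> f v = 0" "f x = 1"
    using cfunctional_separating[OF E rel_dim_Suc(2)] by blast
  have bl: "bounded_linear f" using f(1) by (simp add: cfunctional_def)
  obtain K where K: "K > 0" "\<And>y. cmod (f y) \<le> norm y * K"
    using bounded_linear.pos_bounded[OF bl] by blast
  \<comment> \<open>If \<open>norm y \<le> C\<close>, the coefficient \<open>f y\<close> is at most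
    \<open>C * K\<close>, and removing that multiple of \<open>x\<close> leaves norm at most
    \<open>C + C * K * norm x\<close>.\<close>
  define A where "A = (E \<inter> cball 0 (C + C * K * norm x)) \<times> cball (0::complex) (C * K)"
  have "compact A" unfolding A_def by (intro compact_Times rel_dim_Suc.IH compact_cball)
  then have "compact ((\<lambda>(u, c). u + c *\<^sub>C x) ` A)"
    by (intro compact_continuous_image)
      (auto simp: case_prod_beta intro!: continuous_intros
        bounded_linear.continuous_on[OF bounded_linear_scaleC_left])
  moreover have "closed (cvec.span (insert x E) \<inter> cball 0 C)"
    using closed_adjoin[OF E rel_dim_Suc(2)] by (intro closed_Int) auto
  moreover have "cvec.span (insert x E) \<inter> cball 0 C \<subseteq> (\<lambda>(u, c). u + c *\<^sub>C x) ` A"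
  proof
    fix y assume y: "y \<in> cvec.span (insert x E) \<inter> cball 0 C"
    then obtain k where k: "y - k *\<^sub>C x \<in> E" using mem_adjoin[OF E(1), of y x] by blast
    have "f y - k * f x = 0"
      using f(2)[OF k] unfolding cfunctional_clin(2,3)[OF f(1)] .
    then have fy: "f y = k" using f(3) by simp
    have "cmod k \<le> norm y * K" using K(2)[of y] fy by simp
    also have "\<dots> \<le> C * K" using y K(1) by (intro mult_right_mono) auto
    finally have kb: "cmod k \<le> C * K" .
    have "norm (y - k *\<^sub>C x) \<le> norm y + cmod k * norm x"
      using norm_triangle_ineq4[of y "k *\<^sub>C x"] by (simp add: norm_scaleC)
    also have "\<dots> \<le> C + C * K * norm x" using y kb by (intro add_mono mult_right_mono) auto
    finally have "(y - k *\<^sub>C x, k) \<in> A" using k kb by (simp add: A_def)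
    then show "y \<in> (\<lambda>(u, c). u + c *\<^sub>C x) ` A" by (rule rev_image_eqI) simp
  qed
  ultimately show ?case by (metis compact_Int_closed inf.absorb2 inf_commute)
next
  case rel_dim_0
  have "{0::'a} \<inter> cball 0 C \<subseteq> {0}" by auto
  then show ?case by (metis finite.emptyI finite.insertI finite_imp_compact finite_subset)
qed

text \<open>The colour of \<open>y\<close> is a point of a finite \<open>e / 2\<close>-net near
  \<open>h y\<close>. This is the form in which compactness of finite-dimensional balls is used
  later.\<close>

lemma finite_dim_colouring:
  fixes E :: "'a::complex_normed_vector set"
  assumes "rel_dim {0} E n" "e > 0" and h: "\<And>y. y \<in> S \<Longrightarrow> h y \<in> E \<and> norm (h y) \<le> C"
  obtains g :: "'b \<Rightarrow> 'a" where "finite (g ` S)"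
    "\<And>y y'. y \<in> S \<Longrightarrow> y' \<in> S \<Longrightarrow> g y = g y' \<Longrightarrow> norm (h y - h y') < e"
proof -
  have "\<exists>k. finite k \<and> E \<inter> cball 0 C \<subseteq> (\<Union>x\<in>k. ball x (e / 2))"
    using finite_dim_compact[OF assms(1), of C] assms(2)
    unfolding compact_eq_totally_bounded by (meson half_gt_zero)
  then obtain k where k: "finite k" "E \<inter> cball 0 C \<subseteq> (\<Union>x\<in>k. ball x (e / 2))" by blast
  have "\<exists>a. a \<in> k \<and> dist a (h y) < e / 2" if "y \<in> S" for y
    using k(2) h[OF that] by (auto simp: subset_eq)
  then obtain g where g: "\<And>y. y \<in> S \<Longrightarrow> g y \<in> k \<and> dist (g y) (h y) < e / 2" by metis
  have "finite (g ` S)" using g by (intro finite_subset[OF _ k(1)]) auto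
  moreover have "norm (h y - h y') < e" if "y \<in> S" "y' \<in> S" "g y = g y'" for y y'
    using g[OF that(1)] g[OF that(2)] that(3) dist_triangle_half_r[of "g y" "h y" e "h y'"]
    by (simp add: dist_norm)
  ultimately show ?thesis by (rule that)
qed

section \<open>Open mapping\<close>

lemma geometric_series_in_subspace:
  fixes x :: "nat \<Rightarrow> 'a::banach"
  assumes Y: "subspace Y" "closed Y" and x: "\<And>n. x n \<in> Y" "\<And>n. norm (x n) \<le> A * q ^ n"
    and q: "0 \<le> q" "q < 1"
  obtains s where "x sums s" "s \<in> Y" "norm s \<le> A / (1 - q)"
proof -
  have g: "(\<lambda>n. A * q ^ n) sums (A * (1 / (1 - q)))"
    using q by (intro sums_mult geometric_sums) simp
  have s: "summable x" using x(2) by (rule summable_comparison_test'[OF sums_summable[OF g]])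
  have "x sums suminf x" using s by (rule summable_sums)
  moreover have "suminf x \<in> Y"
    using closed_sequentially[OF Y(2) _ summable_LIMSEQ[OF s]] x(1) Y(1) by (simp add: subspace_sum)
  moreover have "norm (suminf x) \<le> A / (1 - q)"
    using norm_suminf_le[of x, OF x(2) sums_summable[OF g]] sums_unique[OF g] by simp
  ultimately show ?thesis by (rule that)
qed

text \<open>The error is halved in each round and the remainder is treated next; the corrections
  form a geometric series, whence the factor 2. \<open>Z\<close> is only a set that contains all
  remainders.\<close>

lemma approximate_solution_iteration:
  fixes f :: "'a::banach \<Rightarrow> 'b::banach"
  assumes f: "bounded_linear f" and Y: "subspace Y" "closed Y"
    and approx: "\<And>z. z \<in> Z \<Longrightarrow> \<exists>y\<in>Y. norm y \<le> C * norm z \<and> norm (z - f y) \<le> norm z / 2 \<and> z - f y \<in> Z"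
    and z: "z \<in> Z" and C: "C \<ge> 0"
  obtains y where "y \<in> Y" "f y = z" "norm y \<le> 2 * C * norm z"
proof -
  obtain h where h: "\<And>z. z \<in> Z \<Longrightarrow> h z \<in> Y \<and> norm (h z) \<le> C * norm z \<and>
      norm (z - f (h z)) \<le> norm z / 2 \<and> z - f (h z) \<in> Z"
    using approx by metis
  define r where "r n = ((\<lambda>z. z - f (h z)) ^^ n) z" for n
  have r0: "r 0 = z" and rS: "r (Suc n) = r n - f (h (r n))" for n by (simp_all add: r_def)
  have r: "r n \<in> Z \<and> norm (r n) \<le> norm z * (1 / 2) ^ n" for n
  proof (induction n)
    case (Suc n)
    then show ?case using h[of "r n"] by (auto simp: rS)
  qed (simp add: r0 z)
  have "norm (h (r n)) \<le> (C * norm z) * (1 / 2) ^ n" for n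
    using h[of "r n"] r[of n] mult_left_mono[OF conjunct2[OF r[of n]] C]
    by (auto intro: order_trans simp: mult.assoc)
  then obtain s where s: "(\<lambda>n. h (r n)) sums s" "s \<in> Y" "norm s \<le> C * norm z / (1 - 1 / 2)"
    using geometric_series_in_subspace[OF Y, of "\<lambda>n. h (r n)" "C * norm z" "1 / 2"] h r by auto
  have "(\<lambda>n. norm z * (1 / 2) ^ n) \<longlonglongrightarrow> 0"
    by (intro tendsto_mult_right_zero LIMSEQ_power_zero) simp
  then have "r \<longlonglongrightarrow> 0"
    by (rule Lim_null_comparison[rotated]) (use r in auto)
  then have "(\<lambda>n. r n - r (Suc n)) sums (r 0 - 0)" by (rule telescope_sums')
  then have "(\<lambda>n. f (h (r n))) sums z" by (simp add: rS r0)
  moreover have "(\<lambda>n. f (h (r n))) sums f s" using bounded_linear.sums[OF f s(1)] .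
  ultimately have "f s = z" by (rule sums_unique2[rotated])
  then show ?thesis using s(2,3) that by simp
qed

text \<open>Open mapping theorem between closed subspaces in quantitative form: Baire in
  \<open>Z\<close> provides a ball approximated by images of bounded vectors, and the halving
  iteration makes the preimages exact.\<close>

lemma open_mapping_bound:
  fixes f :: "'a::banach \<Rightarrow> 'b::banach"
  assumes f: "bounded_linear f" and Y: "subspace Y" "closed Y" and Z: "subspace Z" "closed Z"
    and fYZ: "f ` Y = Z"
  obtains C where "C > 0" "\<And>z. z \<in> Z \<Longrightarrow> \<exists>y\<in>Y. f y = z \<and> norm y \<le> C * norm z"
proof -
  note lin = bounded_linear.linear[OF f]
  define G where "G n = closure (f ` (Y \<inter> cball 0 (real n)))" for n
  have GZ: "G n \<subseteq> Z" for n
    unfolding G_def using fYZ Z(2) by (intro closure_minimal) auto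
  have "\<exists>n. top_of_set Z interior_of G n \<noteq> {}"
  proof (rule ccontr)
    assume "\<not> ?thesis"
    then have "top_of_set Z interior_of \<Union>(range G) = {}"
      using GZ
      by (intro Baire_category_alt disjI1 completely_metrizable_space_closedin[OF
            completely_metrizable_space_euclidean])
        (auto simp: Z(2) closed_closedin[symmetric] closedin_closed_eq G_def)
    moreover have "\<Union>(range G) = Z"
    proof
      show "\<Union>(range G) \<subseteq> Z" using GZ by auto
      show "Z \<subseteq> \<Union>(range G)"
      proof
        fix z assume "z \<in> Z"
        then obtain y where "y \<in> Y" "f y = z" using fYZ by auto
        moreover have "norm y \<le> real (nat \<lceil>norm y\<rceil>)" by (simp add: real_nat_ceiling_ge)
        ultimately have "z \<in> G (nat \<lceil>norm y\<rceil>)"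
          unfolding G_def by (intro subsetD[OF closure_subset]) auto
        then show "z \<in> \<Union>(range G)" by auto
      qed
    qed
    ultimately have "Z = {}" using interior_of_topspace[of "top_of_set Z"] by simp
    then show False using subspace_0[OF Z(1)] by simp
  qed
  then obtain n z0 where "z0 \<in> top_of_set Z interior_of G n" by blast
  then obtain U where U: "openin (top_of_set Z) U" "z0 \<in> U" "U \<subseteq> G n"
    by (auto simp: interior_of_def)
  then obtain r where r: "r > 0" "ball z0 r \<inter> Z \<subseteq> U" and z0: "z0 \<in> Z"
    unfolding openin_contains_ball by blast
  \<comment> \<open>Vectors of norm \<open>r / 2\<close> have approximate preimages of norm at most
    \<open>2 * n\<close>; rescaling to \<open>norm z\<close> gives \<open>4 * n / r\<close>. The
    added 1 keeps \<open>C\<close> positive when \<open>n = 0\<close>.\<close>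
  define C where "C = 4 * (real n + 1) / r"
  have C: "C > 0" using r by (simp add: C_def)
  \<comment> \<open>The center \<open>z0\<close> is removed by subtracting an approximate preimage
    of \<open>z0\<close> from one of \<open>z0 + z\<close>.\<close>
  have near: "\<exists>y\<in>Y. norm y \<le> 2 * real n \<and> norm (z - f y) < e" if z: "z \<in> Z" "norm z < r" and e: "e > 0" for z e
  proof -
    have "z0 + z \<in> G n" "z0 \<in> G n"
      using U r z z0 Z(1) by (auto simp: dist_norm subspace_add subset_eq)
    then obtain a b where ab: "a \<in> Y" "norm a \<le> real n" "dist (f a) (z0 + z) < e / 2"
      "b \<in> Y" "norm b \<le> real n" "dist (f b) z0 < e / 2"
      using e unfolding G_def closure_approachable
      by (auto dest!: spec[of _ "e / 2"])
    have "z - f (a - b) = (f b - z0) - (f a - (z0 + z))" by (simp add: linear_diff[OF lin])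
    then have "norm (z - f (a - b)) \<le> dist (f b) z0 + dist (f a) (z0 + z)"
      unfolding dist_norm by (metis norm_triangle_ineq4)
    then have "norm (z - f (a - b)) < e" using ab by simp
    moreover have "norm (a - b) \<le> 2 * real n" using ab norm_triangle_ineq4[of a b] by simp
    ultimately show ?thesis using ab Y(1) by (intro bexI[of _ "a - b"]) (auto simp: subspace_diff)
  qed
  have "\<exists>y\<in>Y. norm y \<le> C * norm z \<and> norm (z - f y) \<le> norm z / 2 \<and> z - f y \<in> Z" if z: "z \<in> Z" for z
  proof (cases "z = 0")
    case True
    then show ?thesis
      using subspace_0[OF Y(1)] subspace_0[OF Z(1)] by (intro bexI[of _ 0]) (auto simp: linear_0[OF lin])
  next
    case False
    define s where "s = r / (2 * norm z)"
    have s: "s > 0" using r False by (simp add: s_def)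
    have ns: "norm (s *\<^sub>R z) = r / 2" using r False by (simp add: s_def)
    have "s *\<^sub>R z \<in> Z" "norm (s *\<^sub>R z) < r"
      using z Z(1) r ns by (auto simp: subspace_scale simp del: norm_scaleR)
    then obtain y where y: "y \<in> Y" "norm y \<le> 2 * real n" "norm (s *\<^sub>R z - f y) < r / 4"
      using near[of "s *\<^sub>R z" "r / 4"] r by auto
    define w where "w = (1 / s) *\<^sub>R y"
    have w: "w \<in> Y" using y Y(1) by (simp add: w_def subspace_scale)
    have "norm w = norm y / s" using s by (simp add: w_def)
    also have "\<dots> \<le> 2 * (real n + 1) / s" using y(2) s by (intro divide_right_mono) auto
    also have "\<dots> = C * norm z" using r False by (simp add: C_def s_def)
    finally have nw: "norm w \<le> C * norm z" .
    have "z - f w = (1 / s) *\<^sub>R (s *\<^sub>R z - f y)"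
      using s by (simp add: w_def linear_scale[OF lin] scaleR_diff_right)
    then have "norm (z - f w) = norm (s *\<^sub>R z - f y) / s" using s by simp
    also have "\<dots> \<le> (r / 4) / s" using y(3) s by (intro divide_right_mono) auto
    also have "\<dots> = norm z / 2" using r False by (simp add: s_def)
    finally have "norm (z - f w) \<le> norm z / 2" .
    moreover have "z - f w \<in> Z" using z w fYZ Z(1) by (auto intro: subspace_diff)
    ultimately show ?thesis using w nw by auto
  qed
  then have "\<exists>y\<in>Y. f y = z \<and> norm y \<le> (2 * C) * norm z" if "z \<in> Z" for z
    using approximate_solution_iteration[OF f Y, of Z C z] that C by (metis less_imp_le)
  then show ?thesis using that[of "2 * C"] C by simp
qed

section \<open>Operators with range of finite codimension\<close>

lemma csubspace_subspace: "cvec.subspace (V::'a::complex_normed_vector set) \<Longrightarrow> subspace V"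
  by (auto simp: cvec.subspace_def subspace_def scaleR_scaleC)

lemma finite_codim_bounded_decomposition:
  fixes S :: "'a::complex_banach \<Rightarrow> 'a"
  assumes S: "bounded_clinear S" and Y: "cvec.subspace Y" "closed Y" and Z: "closed Z"
    and q: "rel_dim (S ` Y) Z q"
  obtains F C where "rel_dim {0} F q" "F \<subseteq> Z" "S ` Y \<inter> F = {0}" "C > 0"
    "\<And>z. z \<in> Z \<Longrightarrow> \<exists>y\<in>Y. \<exists>f\<in>F. z = S y + f \<and> norm y \<le> C * norm z \<and> norm f \<le> C * norm z"
proof -
  have sR: "cvec.subspace (S ` Y)" by (rule rel_dim_subspace_lower[OF q])
  have sZ: "cvec.subspace Z" by (rule rel_dim_subspace_upper[OF q])
  obtain F where F: "rel_dim {0} F q" "\<forall>g\<in>F. g \<in> S ` Y \<longrightarrow> g = 0"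
    "Z = {r + g |r g. r \<in> S ` Y \<and> g \<in> F}"
    using rel_dim_lift[of "\<lambda>x. x", OF _ q] by (auto simp: clin_def)
  note sF = rel_dim_subspace_upper[OF F(1)]
  have int: "S ` Y \<inter> F = {0}"
    using F(2) cvec.subspace_0[OF sR] cvec.subspace_0[OF sF] by auto
  have FZ: "F \<subseteq> Z"
  proof
    fix g assume "g \<in> F"
    then have "0 + g \<in> Z" using F(3) cvec.subspace_0[OF sR] by blast
    then show "g \<in> Z" by simp
  qed
  define A where "A = (\<lambda>(y, g). S y + g)"
  have "bounded_linear (\<lambda>x. S (fst x) + snd x)"
    by (intro bounded_linear_add bounded_linear_snd
        bounded_linear_compose[OF bounded_clinear_bounded_linear[OF S] bounded_linear_fst])
  then have bA: "bounded_linear A" by (simp add: A_def case_prod_beta')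
  have "subspace (Y \<times> F)" using Y(1) sF by (simp add: csubspace_subspace subspace_Times)
  moreover have "closed (Y \<times> F)"
    using Y(2) closed_rel_dim[OF F(1)] by (intro closed_Times) auto
  moreover have "A ` (Y \<times> F) = Z" using F(3) by (force simp: A_def)
  ultimately obtain C where C: "C > 0"
    "\<And>z. z \<in> Z \<Longrightarrow> \<exists>y\<in>Y \<times> F. A y = z \<and> norm y \<le> C * norm z"
    using open_mapping_bound[OF bA _ _ csubspace_subspace[OF sZ] Z] by metis
  have "\<exists>y\<in>Y. \<exists>f\<in>F. z = S y + f \<and> norm y \<le> C * norm z \<and> norm f \<le> C * norm z" if "z \<in> Z" for z
  proof -
    obtain y f where yf: "y \<in> Y" "f \<in> F" "A (y, f) = z" "norm (y, f) \<le> C * norm z"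
      using C(2)[OF \<open>z \<in> Z\<close>] by auto
    then show ?thesis
      using norm_fst_le[of y f] norm_snd_le[of f y]
      by (intro bexI[of _ y] bexI[of _ f]) (auto simp: A_def)
  qed
  then show ?thesis using that[OF F(1) FZ int C(1)] by blast
qed

text \<open>The \<open>F\<close>-component is unique and bounded by a multiple of the norm. A limit
  \<open>l\<close> of points \<open>s n\<close> of the image has the same \<open>F\<close>-component
  as \<open>l - s n\<close>, which tends to 0.\<close>

lemma closed_image_finite_codim:
  fixes S :: "'a::complex_banach \<Rightarrow> 'a"
  assumes S: "bounded_clinear S" and Y: "cvec.subspace Y" "closed Y" and Z: "closed Z"
    and q: "rel_dim (S ` Y) Z q"
  shows "closed (S ` Y)"
proof -
  note sY = rel_dim_subspace_lower[OF q]
  obtain F C where F: "rel_dim {0} F q" "F \<subseteq> Z" "S ` Y \<inter> F = {0}" and C: "C > 0"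
    "\<And>z. z \<in> Z \<Longrightarrow> \<exists>y\<in>Y. \<exists>f\<in>F. z = S y + f \<and> norm y \<le> C * norm z \<and> norm f \<le> C * norm z"
    using finite_codim_bounded_decomposition[OF assms] by metis
  note sF = rel_dim_subspace_upper[OF F(1)]
  show ?thesis
    unfolding closed_sequential_limits
  proof (intro allI impI, elim conjE)
    fix s l assume s: "\<forall>n. s n \<in> S ` Y" "s \<longlonglongrightarrow> l"
    have SZ: "S ` Y \<subseteq> Z" by (rule rel_dim_subset[OF q])
    have l: "l \<in> Z" using closed_sequentially[OF Z] s SZ by (meson subsetD)
    obtain y f where yf: "y \<in> Y" "f \<in> F" "l = S y + f" using C(2)[OF l] by blast
    have "norm f \<le> C * norm (l - s n)" for n
    proof -
      have "l - s n \<in> Z"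
        using l s SZ rel_dim_subspace_upper[OF q] by (blast intro: cvec.subspace_diff)
      then obtain y' f' where yf': "y' \<in> Y" "f' \<in> F" "l - s n = S y' + f'"
        "norm f' \<le> C * norm (l - s n)" using C(2) by blast
      have "f - f' = S y' + s n - S y" using yf(3) yf'(3) by (simp add: algebra_simps)
      moreover have "S y' + s n - S y \<in> S ` Y"
        using s(1) yf(1) yf'(1) sY by (intro cvec.subspace_diff cvec.subspace_add) auto
      moreover have "f - f' \<in> F" using sF yf(2) yf'(2) by (rule cvec.subspace_diff)
      ultimately have "f - f' \<in> S ` Y \<inter> F" by (simp only: Int_iff)
      then have "f = f'" using F(3) by auto
      then show ?thesis using yf' by simp
    qed
    moreover have "(\<lambda>n. C * norm (l - s n)) \<longlonglongrightarrow> C * norm (l - l)"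
      by (intro tendsto_intros s)
    ultimately have "norm f \<le> C * norm (l - l)" by (intro LIMSEQ_le_const) auto
    then show "l \<in> S ` Y" using yf by simp
  qed
qed

section \<open>Index and small perturbations\<close>

text \<open>
  Allowing the codomain \<open>Z\<close> of the restriction of \<open>S\<close> to differ from its domain \<open>Y\<close> makes it possible to
  compare indices by enlarging domain and codomain one dimension at a time.
\<close>

definition defects :: "'a::complex_normed_vector set \<Rightarrow> 'a set \<Rightarrow> ('a \<Rightarrow> 'a) \<Rightarrow> nat \<Rightarrow> nat \<Rightarrow> bool" where
  "defects Y Z S p q \<longleftrightarrow> cvec.subspace Y \<and> rel_dim {0} (kernel_on Y S) p \<and> rel_dim (S ` Y) Z q"

lemma defects_unique:
  "defects Y Z S p q \<Longrightarrow> defects Y Z S p' q' \<Longrightarrow> p' = p \<and> q' = q"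
  unfolding defects_def using rel_dim_unique by blast

lemma defects_enlarge_codomain:
  "defects Y Z S p q \<Longrightarrow> rel_dim Z Z' n \<Longrightarrow> defects Y Z' S p (q + n)"
  unfolding defects_def using rel_dim_trans by blast

text \<open>If \<open>S x\<close> is already \<open>S y\<close> with \<open>y\<close> in
  \<open>Y\<close>, the kernel gains \<open>x - y\<close> and the range stays; otherwise the range
  gains \<open>S x\<close> and the kernel stays. In both cases the index grows by one.\<close>

lemma defects_adjoin:
  assumes S: "clin S" and d: "defects Y Z S p q" and x: "x \<notin> Y" "S x \<in> Z"
  shows "\<exists>p' q'. defects (cvec.span (insert x Y)) Z S p' q' \<and> p' + q = p + q' + 1"
proof -
  have Y: "cvec.subspace Y" and p: "rel_dim {0} (kernel_on Y S) p" and q: "rel_dim (S ` Y) Z q"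
    using d by (auto simp: defects_def)
  let ?Y = "cvec.span (insert x Y)"
  have sub: "cvec.subspace ?Y" by simp
  have YY: "Y \<subseteq> ?Y" by (auto intro: cvec.span_base)
  have xY: "x \<in> ?Y" by (auto intro: cvec.span_base)
  have im: "S ` ?Y = cvec.span (insert (S x) (S ` Y))" by (rule clin_image_adjoin[OF S Y])
  note sSY = subspace_clin_image[OF S Y]
  show ?thesis
  proof (cases "S x \<in> S ` Y")
    case True
    then obtain y where y: "y \<in> Y" "S x = S y" by auto
    let ?k = "x - y"
    have Sk: "S ?k = 0" using y by (simp add: clin_diff[OF S])
    have kY: "?k \<notin> Y" using cvec.subspace_add[OF Y, of ?k y] y x by auto
    have "kernel_on ?Y S = cvec.span (insert ?k (kernel_on Y S))"
    proof
      show "kernel_on ?Y S \<subseteq> cvec.span (insert ?k (kernel_on Y S))"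
      proof
        fix z assume z: "z \<in> kernel_on ?Y S"
        then obtain c where c: "z - c *\<^sub>C x \<in> Y" "S z = 0"
          using mem_adjoin[OF Y, of z x] by (auto simp: kernel_on_def)
        have "(z - c *\<^sub>C x) + c *\<^sub>C y \<in> Y"
          using Y c y by (intro cvec.subspace_add cvec.subspace_scale)
        then have "z - c *\<^sub>C ?k \<in> Y" by (simp add: cvec.scale_right_diff_distrib algebra_simps)
        moreover have "S (z - c *\<^sub>C ?k) = 0" using c Sk by (simp only: clin_diff[OF S] clin_scale[OF S]) simp
        ultimately have "z - c *\<^sub>C ?k \<in> kernel_on Y S" by (simp only: kernel_on_def) simp
        then show "z \<in> cvec.span (insert ?k (kernel_on Y S))"
          using mem_adjoin[OF subspace_kernel_on[OF S Y], of z ?k] by blast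
      qed
      have "?k \<in> ?Y" using xY y YY sub by (blast intro: cvec.subspace_diff)
      then show "cvec.span (insert ?k (kernel_on Y S)) \<subseteq> kernel_on ?Y S"
        using Sk YY by (intro cvec.span_minimal subspace_kernel_on[OF S]) (auto simp: kernel_on_def)
    qed
    then have "rel_dim {0} (kernel_on ?Y S) (Suc p)"
      using rel_dim_Suc[OF p, of ?k] kY by (simp add: kernel_on_def)
    moreover have "S ` ?Y = S ` Y" unfolding im using True sSY by (simp add: insert_absorb)
    ultimately have "defects ?Y Z S (Suc p) q" using q by (simp add: defects_def)
    then show ?thesis by (intro exI[of _ "Suc p"] exI[of _ q]) simp
  next
    case False
    obtain m where m: "q = Suc m" "rel_dim (S ` ?Y) Z m"
      using rel_dim_adjoin_lower[OF q x(2) False] unfolding im by blast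
    have "kernel_on ?Y S = kernel_on Y S"
    proof
      show "kernel_on ?Y S \<subseteq> kernel_on Y S"
      proof
        fix z assume z: "z \<in> kernel_on ?Y S"
        then obtain c where c: "z - c *\<^sub>C x \<in> Y" "S z = 0"
          using mem_adjoin[OF Y, of z x] by (auto simp: kernel_on_def)
        have "- (c *\<^sub>C S x) = S (z - c *\<^sub>C x)" using c by (simp add: clin_diff[OF S] clin_scale[OF S])
        then have "c *\<^sub>C S x \<in> S ` Y" using c(1) cvec.subspace_neg[OF sSY] by (metis imageI minus_minus)
        then have "inverse c *\<^sub>C c *\<^sub>C S x \<in> S ` Y" by (rule cvec.subspace_scale[OF sSY])
        then have "c = 0" using False by (cases "c = 0") auto
        then show "z \<in> kernel_on Y S" using c by (simp add: kernel_on_def)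
      qed
      show "kernel_on Y S \<subseteq> kernel_on ?Y S" using YY by (auto simp: kernel_on_def)
    qed
    then have "defects ?Y Z S p m" using p m sub by (simp add: defects_def)
    then show ?thesis using m by (intro exI[of _ p] exI[of _ m]) simp
  qed
qed

lemma defects_enlarge_domain:
  assumes S: "clin S" and n: "rel_dim Y Y' n" and d: "defects Y Z S p q" and "S ` Y' \<subseteq> Z"
  shows "\<exists>p' q'. defects Y' Z S p' q' \<and> p' + q = p + q' + n"
  using n assms(4)
proof (induction rule: rel_dim.induct)
  case rel_dim_0
  then show ?case using d by auto
next
  case (rel_dim_Suc W n x)
  have W: "W \<subseteq> cvec.span (insert x W)" "x \<in> cvec.span (insert x W)" by (auto intro: cvec.span_base)
  then obtain p' q' where *: "defects W Z S p' q'" "p' + q = p + q' + n"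
    using rel_dim_Suc.IH rel_dim_Suc.prems by blast
  then show ?case
    using defects_adjoin[OF S *(1) rel_dim_Suc.hyps(2)] rel_dim_Suc.prems W by fastforce
qed

lemma defects_restrict_range:
  assumes S: "clin S" and d: "defects Y Y S p q"
  shows "\<exists>p' q'. defects (S ` Y) (S ` Y) S p' q' \<and> p' + q = p + q'"
proof -
  have Y: "cvec.subspace Y" and p: "rel_dim {0} (kernel_on Y S) p" and q: "rel_dim (S ` Y) Y q"
    using d by (auto simp: defects_def)
  have SY: "S ` Y \<subseteq> Y" by (rule rel_dim_subset[OF q])
  have sSY: "cvec.subspace (S ` Y)" by (rule rel_dim_subspace_lower[OF q])
  have k: "kernel_on (S ` Y) S \<subseteq> kernel_on Y S" using SY by (auto simp: kernel_on_def)
  obtain p' where p': "rel_dim {0} (kernel_on (S ` Y) S) p'"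
    using rel_dim_split[OF p subspace_kernel_on[OF S sSY] _ k]
      cvec.subspace_0[OF subspace_kernel_on[OF S sSY]] by auto
  obtain q' where q': "rel_dim (S ` S ` Y) (S ` Y) q'"
    using rel_dim_image[OF S q] by blast
  have *: "defects (S ` Y) (S ` Y) S p' q'" using p' q' sSY by (simp add: defects_def)
  from defects_enlarge_codomain[OF this q] have "defects (S ` Y) Y S p' (q' + q)" .
  from defects_enlarge_domain[OF S q this SY] obtain p'' q'' where
    "defects Y Y S p'' q''" "p'' + (q' + q) = p' + q'' + q" by blast
  moreover then have "p'' = p" "q'' = q" using defects_unique[OF d] by auto
  ultimately show ?thesis using * by (intro exI[of _ p'] exI[of _ q']) simp
qed

lemma bounded_clinear_shift:
  "bounded_clinear T \<Longrightarrow> bounded_clinear (\<lambda>x. T x - l *\<^sub>C x)"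
  unfolding bounded_clinear_def
  by (auto intro!: bounded_linear_sub bounded_linear_scaleC_right
      simp: cvec.scale_right_diff_distrib mult.commute)

text \<open>With \<open>K\<close> a closed complement of the kernel and \<open>F\<close> a
  complement of the range, \<open>(y, f) \<mapsto> T y + f\<close> is a bijection from
  \<open>K \<times> F\<close> to \<open>M\<close> with bounds \<open>C\<close> on the components of
  its inverse. It stays bijective after a shift below \<open>1 / (2 * C)\<close>, so the shifted
  operator from \<open>K\<close> to \<open>M\<close> has defects \<open>0\<close> and
  \<open>q\<close>; enlarging \<open>K\<close> to \<open>M\<close> adds \<open>p\<close> to the
  index.\<close>

lemma defects_small_perturbation:
  fixes T :: "'a::complex_banach \<Rightarrow> 'a"
  assumes T: "bounded_clinear T" and M: "closed M" and d: "defects M M T p q"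
  shows "\<exists>e>0. \<forall>l. cmod l < e \<longrightarrow>
    (\<exists>p' q'. defects M M (\<lambda>x. T x - l *\<^sub>C x) p' q' \<and> p' + q = p + q')"
proof -
  note cl = bounded_clinear_clin[OF T]
  have sM: "cvec.subspace M" and p: "rel_dim {0} (kernel_on M T) p" and q: "rel_dim (T ` M) M q"
    using d by (auto simp: defects_def)
  have TM: "T ` M \<subseteq> M" by (rule rel_dim_subset[OF q])
  define E where "E = kernel_on M T"
  have sE: "cvec.subspace E" unfolding E_def by (rule subspace_kernel_on[OF cl sM])
  have EM: "E \<subseteq> M" by (auto simp: E_def kernel_on_def)
  obtain P where P: "bounded_clinear P" "range P \<subseteq> E" "\<forall>x\<in>E. P x = x"
    using finite_dim_projection[OF p] by (auto simp: E_def)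
  note clP = bounded_clinear_clin[OF P(1)]
  define K where "K = kernel_on M P"
  have sK: "cvec.subspace K" unfolding K_def by (rule subspace_kernel_on[OF clP sM])
  have KM: "K \<subseteq> M" by (auto simp: K_def kernel_on_def)
  have clK: "closed K"
  proof -
    have "K = M \<inter> P -` {0}" by (auto simp: K_def kernel_on_def)
    then show ?thesis
      using M linear_continuous_at[OF bounded_clinear_bounded_linear[OF P(1)]]
      by (auto intro!: closed_Int continuous_closed_vimage)
  qed
  have KE: "K \<inter> E = {0}"
    using P(3) cvec.subspace_0[OF sK] cvec.subspace_0[OF sE] by (auto simp: K_def kernel_on_def)
  have split: "x - P x \<in> K \<and> P x \<in> E" if "x \<in> M" for x
  proof -
    have "P x \<in> E" using P(2) by auto
    moreover have "P (x - P x) = 0" using P(3) calculation by (simp add: clin_diff[OF clP])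
    moreover have "x - P x \<in> M" using calculation that EM sM by (blast intro: cvec.subspace_diff)
    ultimately show ?thesis by (simp add: K_def kernel_on_def)
  qed
  have "cvec.span (K \<union> E) = M"
  proof
    show "cvec.span (K \<union> E) \<subseteq> M" using KM EM sM by (intro cvec.span_minimal) auto
    show "M \<subseteq> cvec.span (K \<union> E)"
    proof
      fix x assume "x \<in> M"
      then have "(x - P x) + P x \<in> cvec.span (K \<union> E)"
        using split by (intro cvec.span_add) (auto intro: cvec.span_base)
      then show "x \<in> cvec.span (K \<union> E)" by simp
    qed
  qed
  then have KMp: "rel_dim K M p" using rel_dim_sum[OF p[folded E_def] sK KE] by simp
  have "T ` K = T ` M"
  proof
    show "T ` K \<subseteq> T ` M" using KM by auto
    show "T ` M \<subseteq> T ` K"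
    proof
      fix y assume "y \<in> T ` M"
      then obtain x where x: "x \<in> M" "y = T x" by auto
      then have "T (x - P x) = y" using split[OF x(1)] by (simp add: clin_diff[OF cl] E_def kernel_on_def)
      then show "y \<in> T ` K" using split[OF x(1)] by blast
    qed
  qed
  then have "rel_dim (T ` K) M q" using q by simp
  then obtain F C where F: "rel_dim {0} F q" "F \<subseteq> M" "T ` K \<inter> F = {0}" and C: "C > 0"
    "\<And>z. z \<in> M \<Longrightarrow> \<exists>y\<in>K. \<exists>f\<in>F. z = T y + f \<and> norm y \<le> C * norm z \<and> norm f \<le> C * norm z"
    using finite_codim_bounded_decomposition[OF T sK clK M] by metis
  note sF = rel_dim_subspace_upper[OF F(1)]
  have "\<exists>p' q'. defects M M (\<lambda>x. T x - l *\<^sub>C x) p' q' \<and> p' + q = p + q'"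
    if l: "cmod l < 1 / (2 * C)" for l
  proof -
    define S where "S x = T x - l *\<^sub>C x" for x
    have S: "bounded_clinear S" unfolding S_def using bounded_clinear_shift[OF T] .
    note clS = bounded_clinear_clin[OF S]
    have lC: "cmod l * C \<le> 1 / 2" using l C(1) by (simp add: field_simps)
    have SM: "S x \<in> M" if "x \<in> M" for x
      unfolding S_def using that TM sM by (auto intro!: cvec.subspace_diff cvec.subspace_scale)
    have bound: "norm (l *\<^sub>C y) \<le> norm z / 2" if "norm y \<le> C * norm z" for y z :: 'a
    proof -
      have "norm (l *\<^sub>C y) \<le> cmod l * (C * norm z)"
        unfolding norm_scaleC using that by (intro mult_left_mono) auto
      also have "\<dots> \<le> (1 / 2) * norm z"
        using mult_right_mono[OF lC, of "norm z"] by (simp add: mult.assoc)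
      finally show ?thesis by simp
    qed
    \<comment> \<open>By uniqueness, the bounded decomposition of \<open>l y\<close> must be the
      given one, \<open>T y + f\<close>; hence the norm of \<open>l y\<close> is at most half of
      itself.\<close>
    have small: "y = 0 \<and> f = 0" if "y \<in> K" "f \<in> F" "S y + f = 0" for y f
    proof -
      have "l *\<^sub>C y \<in> M" using that KM sM by (auto intro: cvec.subspace_scale)
      then obtain y' f' where y': "y' \<in> K" "f' \<in> F" "l *\<^sub>C y = T y' + f'"
        "norm y' \<le> C * norm (l *\<^sub>C y)" using C(2) by blast
      have eq: "T y + f = l *\<^sub>C y" using that(3) by (simp add: S_def algebra_simps)
      then have "T (y - y') = f' - f" using y'(3) by (simp add: clin_diff[OF cl] algebra_simps)
      moreover have "y - y' \<in> K" using that y' sK by (auto intro: cvec.subspace_diff)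
      moreover have "f' - f \<in> F" using that y' sF by (auto intro: cvec.subspace_diff)
      ultimately have "T (y - y') \<in> T ` K \<inter> F" by (metis IntI imageI)
      then have "T (y - y') = 0" using F(3) by auto
      then have "y - y' \<in> E"
        using \<open>y - y' \<in> K\<close> KM by (auto simp: E_def kernel_on_def)
      then have "y - y' \<in> K \<inter> E" using \<open>y - y' \<in> K\<close> by (simp only: Int_iff)
      then have "y = y'" unfolding KE by simp
      then have "norm (l *\<^sub>C y) \<le> norm (l *\<^sub>C y) / 2"
        using bound[of y "l *\<^sub>C y"] y'(4) by simp
      then have "l *\<^sub>C y = 0" by simp
      \<comment> \<open>Since \<open>l = 0\<close> is allowed, \<open>y = 0\<close> is drawn from
        the bound on \<open>y'\<close> and not by cancelling \<open>l\<close>.\<close>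
      then have "norm y' \<le> 0" using y'(4) by (simp del: cvec.scale_eq_0_iff)
      then have "y = 0" using \<open>y = y'\<close> by simp
      then show ?thesis using that(3) by (simp add: clin_0[OF clS])
    qed
    have sSK: "cvec.subspace (S ` K)" by (rule subspace_clin_image[OF clS sK])
    have int: "S ` K \<inter> F = {0}"
    proof -
      have "f = 0" if "f \<in> F" "y \<in> K" "f = S y" for f y
        using small[OF that(2) cvec.subspace_neg[OF sF that(1)]] that(3) by (auto simp: clin_0[OF clS])
      then show ?thesis using cvec.subspace_0[OF sSK] cvec.subspace_0[OF sF] by auto
    qed
    have "cvec.span (S ` K \<union> F) = M"
    proof
      show "cvec.span (S ` K \<union> F) \<subseteq> M" using SM KM F(2) sM by (intro cvec.span_minimal) auto
      show "M \<subseteq> cvec.span (S ` K \<union> F)"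
      proof
        fix z assume z: "z \<in> M"
        define A where "A x = S (fst x) + snd x" for x
        have bA: "bounded_linear A"
          unfolding A_def
          by (intro bounded_linear_add bounded_linear_snd
              bounded_linear_compose[OF bounded_clinear_bounded_linear[OF S] bounded_linear_fst])
        have sub: "subspace (K \<times> F)" using sK sF by (simp add: csubspace_subspace subspace_Times)
        have clo: "closed (K \<times> F)" using clK closed_rel_dim[OF F(1)] by (intro closed_Times) auto
        \<comment> \<open>The unperturbed solution leaves the remainder \<open>l y\<close>, which
          the bound on \<open>l\<close> halves; the factor 2 combines the bounds of the two
          components.\<close>
        have "\<exists>x\<in>K \<times> F. norm x \<le> (2 * C) * norm w \<and> norm (w - A x) \<le> norm w / 2 \<and> w - A x \<in> M"
          if w: "w \<in> M" for w
        proof -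
          obtain y f where yf: "y \<in> K" "f \<in> F" "w = T y + f" "norm y \<le> C * norm w" "norm f \<le> C * norm w"
            using C(2)[OF w] by blast
          have "w - A (y, f) = l *\<^sub>C y" using yf(3) by (simp add: A_def S_def)
          moreover have "norm (y, f) \<le> norm y + norm f" by (rule norm_Pair_le)
          ultimately show ?thesis
            using yf bound[OF yf(4)] KM sM
            by (intro bexI[of _ "(y, f)"]) (auto intro: cvec.subspace_scale)
        qed
        note approx = this
        have "0 \<le> 2 * C" using C(1) by simp
        then obtain x where "x \<in> K \<times> F" "A x = z"
          using approximate_solution_iteration[OF bA sub clo approx z] by metis
        then show "z \<in> cvec.span (S ` K \<union> F)"
          unfolding A_def by (auto intro!: cvec.span_add intro: cvec.span_base)
      qed
    qed
    then have "rel_dim (S ` K) M q" using rel_dim_sum[OF F(1) sSK int] by simp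
    moreover have "kernel_on K S = {0}"
      using small[of _ 0] cvec.subspace_0[OF sK] cvec.subspace_0[OF sF] clin_0[OF clS]
      by (auto simp: kernel_on_def)
    ultimately have "defects K M S 0 q" using sK by (simp add: defects_def rel_dim_0_iff)
    from defects_enlarge_domain[OF clS KMp this] SM
    obtain p' q' where "defects M M S p' q'" "p' + q = 0 + q' + p" by auto
    then show ?thesis unfolding S_def by (intro exI[of _ p'] exI[of _ q']) simp
  qed
  then show ?thesis using C(1) by (intro exI[of _ "1 / (2 * C)"]) auto
qed

section \<open>Small shifts of Kato operators\<close>

text \<open>
  A substitute for arguing with annihilators in the dual: a finite set of representatives of the
  colours spans \<open>M\<close> up to \<open>R\<close> and half the norm, hence spans \<open>M\<close> modulo \<open>R\<close>.
\<close>

lemma finite_codim_of_colouring: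
  fixes R M :: "'a::complex_normed_vector set"
  assumes R: "cvec.subspace R" "closed R" and M: "cvec.subspace M" and RM: "R \<subseteq> M"
    and fin: "finite (g ` (M \<inter> cball 0 1))"
    and g: "\<And>y y'. y \<in> M \<inter> cball 0 1 \<Longrightarrow> y' \<in> M \<inter> cball 0 1 \<Longrightarrow> g y = g y' \<Longrightarrow>
      \<exists>r\<in>R. norm (y - y' - r) \<le> 1 / 2"
  shows "\<exists>n. rel_dim R M n"
proof -
  obtain B where B: "B \<subseteq> M \<inter> cball 0 1" "finite B" "g ` (M \<inter> cball 0 1) = g ` B"
    using finite_subset_image[OF fin subset_refl] by blast
  define V where "V = cvec.span (R \<union> B)"
  obtain n where "rel_dim R V n" using rel_dim_span_finite[OF B(2) R(1)] by (auto simp: V_def)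
  then have clV: "closed V" using R(2) by (rule closed_rel_dim)
  have sV: "cvec.subspace V" by (simp add: V_def)
  then have neV: "V \<noteq> {}" using cvec.subspace_0 by auto
  have VM: "V \<subseteq> M" unfolding V_def using RM B(1) M by (intro cvec.span_minimal) auto
  have half: "infdist y V \<le> norm y / 2" if y: "y \<in> M" for y
  proof (cases "y = 0")
    case True
    then show ?thesis using cvec.subspace_0[OF sV] by simp
  next
    case False
    define u where "u = (1 / norm y) *\<^sub>R y"
    have "norm u = 1" using False by (simp add: u_def)
    moreover have "u \<in> M" using y M by (simp add: u_def scaleR_scaleC cvec.subspace_scale)
    ultimately have u: "u \<in> M \<inter> cball 0 1" by simp
    then obtain b where b: "b \<in> B" "g u = g b" using B(3) by blast
    then obtain r where r: "r \<in> R" "norm (u - b - r) \<le> 1 / 2" using g[OF u _ b(2)] B(1) by blast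
    have "norm y *\<^sub>R (b + r) \<in> V"
      unfolding V_def scaleR_scaleC using b(1) r(1)
      by (auto intro!: cvec.span_scale cvec.span_add intro: cvec.span_base)
    then have "infdist y V \<le> dist y (norm y *\<^sub>R (b + r))" by (rule infdist_le)
    also have "y - norm y *\<^sub>R (b + r) = norm y *\<^sub>R (u - b - r)"
      using False by (simp add: u_def scaleR_diff_right scaleR_add_right)
    then have "dist y (norm y *\<^sub>R (b + r)) = norm y * norm (u - b - r)" by (simp add: dist_norm)
    also have "\<dots> \<le> norm y * (1 / 2)" using r(2) by (intro mult_left_mono) auto
    finally show ?thesis by simp
  qed
  have "M \<subseteq> V"
  proof
    fix y assume y: "y \<in> M"
    \<comment> \<open>For \<open>v\<close> almost nearest to \<open>y\<close>, \<open>half\<close>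
      applied to \<open>y - v\<close> shows that the distance from \<open>y\<close> to
      \<open>V\<close> is, up to \<open>e\<close>, at most half of itself.\<close>
    have "infdist y V \<le> 0 + e" if e: "e > 0" for e
    proof -
      obtain v where v: "v \<in> V" "dist y v < infdist y V + e"
        using infdist_less_obtain[OF _ neV, of y "infdist y V + e"] e by auto
      have "infdist y V \<le> infdist (y - v) V + infdist v V"
        using sublinear_add[OF sublinear_infdist[OF sV], of "y - v" v] by simp
      also have "infdist (y - v) V \<le> norm (y - v) / 2"
        using half v(1) VM y M by (blast intro: cvec.subspace_diff)
      finally show ?thesis using v e by (simp add: dist_norm)
    qed
    then have "infdist y V \<le> 0" by (rule field_le_epsilon)
    then have "infdist y V = 0" using infdist_nonneg[of y V] by simp
    then show "y \<in> V" using in_closed_iff_infdist_zero[OF clV neV] by blast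
  qed
  then show ?thesis using rel_dim_cover[OF R(1) M RM B(2)] by (simp add: V_def)
qed

section \<open>Kernels and ranges of a Kato operator and its small shifts\<close>

lemma funpow_invariant: "T ` M \<subseteq> M \<Longrightarrow> x \<in> M \<Longrightarrow> (T ^^ n) x \<in> M"
  by (induction n) auto

text \<open>\<open>T\<close> maps the intersection \<open>H\<close> of all \<open>T^n M\<close> onto
  itself with the bound \<open>C\<close> of the whole range, so the chain can always be continued.
  The terms from index 1 on form the correction \<open>s\<close>; with \<open>c = cmod l * C\<close>
  it is at most \<open>c / (1 - c)\<close> times \<open>norm u\<close>, and
  \<open>c \<le> 1/2\<close> turns this into the factor \<open>2 * c\<close>.\<close>

lemma kato_kernel_lift:
  fixes T :: "'a::complex_banach \<Rightarrow> 'a"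
  assumes T: "bounded_clinear T" and M: "cvec.subspace M" "closed M" and TM: "T ` M \<subseteq> M"
    and ker: "\<And>n. kernel_on M T \<subseteq> (T ^^ n) ` M"
    and C: "C > 0" "\<And>z. z \<in> T ` M \<Longrightarrow> \<exists>y\<in>M. T y = z \<and> norm y \<le> C * norm z"
    and l: "cmod l * C \<le> 1 / 2" and u: "u \<in> kernel_on M T"
  obtains v where "v \<in> kernel_on M (\<lambda>x. T x - l *\<^sub>C x)" "norm (u - v) \<le> 2 * (cmod l * C) * norm u"
proof -
  note cl = bounded_clinear_clin[OF T]
  define H where "H = (\<Inter>n. (T ^^ n) ` M)"
  have uH: "u \<in> H" using ker u by (auto simp: H_def)
  have HM: "x \<in> M" if "x \<in> H" for x
  proof -
    have "x \<in> (T ^^ 0) ` M" using that unfolding H_def by blast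
    then show ?thesis by simp
  qed
  \<comment> \<open>Here the Kato condition enters: \<open>x\<close> differs from some
    \<open>T^n w\<close> by a kernel vector, and that vector also lies in \<open>T^n M\<close>.
    Hence any preimage in \<open>M\<close> will do, in particular the bounded one.\<close>
  have pre: "x \<in> H" if x: "x \<in> M" "T x \<in> H" for x
    unfolding H_def
  proof
    fix n
    from x(2) have "T x \<in> (T ^^ Suc n) ` M" unfolding H_def by blast
    then obtain w where w: "w \<in> M" "T x = T ((T ^^ n) w)" by auto
    then have "x - (T ^^ n) w \<in> kernel_on M T"
      using x(1) M(1) funpow_invariant[OF TM w(1)]
      by (simp add: kernel_on_def clin_diff[OF cl] cvec.subspace_diff)
    then have "x - (T ^^ n) w \<in> (T ^^ n) ` M" using ker by blast
    then have "(x - (T ^^ n) w) + (T ^^ n) w \<in> (T ^^ n) ` M"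
      using w(1) by (intro cvec.subspace_add subspace_clin_image[OF clin_funpow[OF cl] M(1)]) auto
    then show "x \<in> (T ^^ n) ` M" by simp
  qed
  have "\<exists>y\<in>H. T y = x \<and> norm y \<le> C * norm x" if x: "x \<in> H" for x
  proof -
    have "x \<in> (T ^^ 1) ` M" using x unfolding H_def by blast
    then have "x \<in> T ` M" by simp
    then obtain y where "y \<in> M" "T y = x" "norm y \<le> C * norm x" using C(2) by blast
    then show ?thesis using pre x by blast
  qed
  then obtain h where h: "\<And>x. x \<in> H \<Longrightarrow> h x \<in> H \<and> T (h x) = x \<and> norm (h x) \<le> C * norm x"
    by metis
  define x where "x n = (h ^^ n) u" for n
  have x0: "x 0 = u" and xS: "x (Suc n) = h (x n)" for n by (simp_all add: x_def)
  have xH: "x n \<in> H" for n by (induction n) (auto simp: x0 xS uH h)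
  have Tx: "T (x (Suc n)) = x n" for n using h[OF xH] by (simp add: xS)
  have nx: "norm (x n) \<le> C ^ n * norm u" for n
  proof (induction n)
    case (Suc n)
    have "norm (x (Suc n)) \<le> C * norm (x n)" using h[OF xH] by (simp add: xS)
    also have "\<dots> \<le> C * (C ^ n * norm u)" using Suc C(1) by (intro mult_left_mono) auto
    finally show ?case by simp
  qed (simp add: x0)
  define a where "a n = l ^ n *\<^sub>C x n" for n
  have "norm (a (Suc n)) \<le> (cmod l * C * norm u) * (cmod l * C) ^ n" for n
  proof -
    have "norm (a (Suc n)) \<le> cmod l ^ Suc n * (C ^ Suc n * norm u)"
      unfolding a_def norm_scaleC norm_power by (intro mult_left_mono nx) simp
    then show ?thesis by (simp add: power_mult_distrib mult_ac)
  qed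
  moreover have "a (Suc n) \<in> M" for n
    unfolding a_def using HM[OF xH] M(1) by (simp add: cvec.subspace_scale)
  moreover have "0 \<le> cmod l * C" "cmod l * C < 1" using l C(1) by auto
  ultimately obtain s where s: "(\<lambda>n. a (Suc n)) sums s" "s \<in> M"
    "norm s \<le> cmod l * C * norm u / (1 - cmod l * C)"
    using geometric_series_in_subspace[OF csubspace_subspace[OF M(1)] M(2),
        of "\<lambda>n. a (Suc n)" "cmod l * C * norm u" "cmod l * C"] by blast
  have "a sums (s + a 0)" using s(1) by (simp add: sums_Suc_iff)
  then have "(\<lambda>n. l *\<^sub>C a n) sums (l *\<^sub>C (s + a 0))"
    by (rule bounded_linear.sums[OF bounded_linear_scaleC_right])
  \<comment> \<open>\<open>T\<close> moves the series down by one index, so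
    \<open>T s = l (s + u)\<close>, and \<open>u + s\<close> is killed by the shifted
    operator.\<close>
  moreover have "T (a (Suc n)) = l *\<^sub>C a n" for n
    by (simp add: a_def clin_scale[OF cl] Tx)
  moreover have "(\<lambda>n. T (a (Suc n))) sums T s"
    using bounded_linear.sums[OF bounded_clinear_bounded_linear[OF T] s(1)] .
  ultimately have Ts: "T s = l *\<^sub>C (s + u)" using sums_unique2 by (simp add: a_def x0) 
  have uM: "u \<in> M" "T u = 0" using u by (auto simp: kernel_on_def)
  have "u + s \<in> kernel_on M (\<lambda>x. T x - l *\<^sub>C x)"
    using uM s(2) M(1) Ts by (simp add: kernel_on_def cvec.subspace_add clin_add[OF cl] add.commute)
  moreover have "norm (u - (u + s)) \<le> 2 * (cmod l * C) * norm u"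
  proof -
    have "norm s \<le> cmod l * C * norm u / (1 - cmod l * C)" by (rule s(3))
    also have "\<dots> \<le> cmod l * C * norm u / (1 / 2)"
      using l C(1) by (intro divide_left_mono) auto
    finally show ?thesis by simp
  qed
  ultimately show ?thesis by (rule that)
qed

text \<open>Closeness of kernels gives closeness of ranges. Write \<open>z = T x - l x\<close> with
  \<open>x\<close> almost as short as possible modulo the kernel \<open>E\<close> of the shift. A
  short \<open>w\<close> with \<open>T w = T x\<close> leaves \<open>x - w\<close> in the kernel of
  \<open>T\<close>, hence near \<open>E\<close>; so \<open>norm x\<close> is controlled by
  \<open>C * norm z\<close>, and \<open>T x\<close> differs from \<open>z\<close> only by
  \<open>l x\<close>.\<close>

lemma kato_range_gap:
  fixes T :: "'a::complex_banach \<Rightarrow> 'a"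
  assumes T: "bounded_clinear T" and M: "cvec.subspace M" "closed M" and TM: "T ` M \<subseteq> M"
    and ker: "\<And>n. kernel_on M T \<subseteq> (T ^^ n) ` M"
    and C: "C > 0" "\<And>z. z \<in> T ` M \<Longrightarrow> \<exists>y\<in>M. T y = z \<and> norm y \<le> C * norm z"
    and l: "cmod l * C \<le> 1 / 32" and z: "z \<in> (\<lambda>x. T x - l *\<^sub>C x) ` M"
  shows "\<exists>r\<in>T ` M. norm (z - r) \<le> norm z / 8"
proof -
  note cl = bounded_clinear_clin[OF T]
  define S where "S = (\<lambda>x. T x - l *\<^sub>C x)"
  have S: "bounded_clinear S" unfolding S_def by (rule bounded_clinear_shift[OF T])
  note clS = bounded_clinear_clin[OF S]
  define E where "E = kernel_on M S"
  have sE: "cvec.subspace E" unfolding E_def by (rule subspace_kernel_on[OF clS M(1)])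
  have neE: "E \<noteq> {}" using cvec.subspace_0[OF sE] by auto
  have "E = M \<inter> S -` {0}" by (auto simp: E_def kernel_on_def)
  then have clE: "closed E"
    using M linear_continuous_at[OF bounded_clinear_bounded_linear[OF S]]
    by (auto intro!: closed_Int continuous_closed_vimage)
  obtain x0 where x0: "x0 \<in> M" "z = S x0" using z by (auto simp: S_def)
  show ?thesis
  proof (cases "x0 \<in> E")
    case True
    then have "z = 0" using x0 by (simp add: E_def kernel_on_def)
    then show ?thesis
      using cvec.subspace_0[OF subspace_clin_image[OF cl M(1)]] by (intro bexI[of _ 0]) auto
  next
    case False
    define d where "d = infdist x0 E"
    have d: "d > 0" unfolding d_def by (rule infdist_pos_not_in_closed[OF clE neE False])
    \<comment> \<open>A nearest point of \<open>E\<close> need not exist; a point within twice the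
      distance suffices, and subtracting it does not change the image \<open>z\<close>.\<close>
    obtain v0 where v0: "v0 \<in> E" "dist x0 v0 < 2 * d"
      using infdist_less_obtain[OF _ neE, of x0 "2 * d"] d by (auto simp: d_def)
    define x where "x = x0 - v0"
    have xM: "x \<in> M" using x0 v0 M(1) by (auto simp: x_def E_def kernel_on_def intro: cvec.subspace_diff)
    have Sx: "S x = z" using x0 v0 by (simp add: x_def clin_diff[OF clS] E_def kernel_on_def)
    have "d \<le> infdist x E + infdist v0 E"
      using sublinear_add[OF sublinear_infdist[OF sE], of x v0] by (simp add: x_def d_def)
    then have xd: "norm x \<le> 2 * infdist x E" using v0 by (simp add: x_def dist_norm)
    define L where "L = cmod l * norm x"
    have LX: "C * L \<le> norm x / 32"
      using mult_right_mono[OF l, of "norm x"] by (simp add: L_def mult_ac)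
    have Txz: "norm (T x - z) = L"
      unfolding Sx[symmetric] by (simp add: S_def norm_scaleC L_def)
    then have nT: "norm (T x) \<le> norm z + L" using norm_triangle_sub[of "T x" z] by simp
    obtain w where w: "w \<in> M" "T w = T x" "norm w \<le> C * norm (T x)" using C(2) xM by blast
    have "C * norm (T x) \<le> C * (norm z + L)" using nT C(1) by (intro mult_left_mono) auto
    then have nw: "norm w \<le> C * norm z + norm x / 32" using w(3) LX by (simp add: distrib_left)
    define u where "u = x - w"
    have u: "u \<in> kernel_on M T"
      using xM w M(1) by (simp add: u_def kernel_on_def clin_diff[OF cl] cvec.subspace_diff)
    obtain v where v: "v \<in> E" "norm (u - v) \<le> 2 * (cmod l * C) * norm u"
      using kato_kernel_lift[OF T M TM ker C _ u, of l] l by (auto simp: E_def S_def)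
    have nu: "norm u \<le> norm x + norm w" unfolding u_def by (rule norm_triangle_ineq4)
    have "2 * (cmod l * C) * norm u \<le> (1 / 16) * (norm x + norm w)"
      using l nu C(1) by (intro mult_mono) auto
    then have uv: "norm (u - v) \<le> (norm x + norm w) / 16" using v(2) by simp
    have "infdist x E \<le> norm (x - v)" using infdist_le[OF v(1), of x] by (simp add: dist_norm)
    also have "x - v = w + (u - v)" by (simp add: u_def)
    also have "norm (w + (u - v)) \<le> norm w + norm (u - v)" by (rule norm_triangle_ineq)
    finally have "infdist x E \<le> norm w + norm (u - v)" .
    then have "norm x \<le> 2 * norm w + 2 * norm (u - v)" using xd by linarith
    then have "norm x \<le> 2 * norm w + 2 * ((norm x + norm w) / 16)" using uv by linarith
    moreover have "0 \<le> C * norm z" using C(1) by simp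
    \<comment> \<open>Solving the inequality for \<open>norm x\<close> gives the factor 4; the bound
      \<open>1 / 32\<close> on \<open>cmod l * C\<close> then produces the \<open>1 / 8\<close> of
      the conclusion.\<close>
    ultimately have "norm x \<le> 4 * (C * norm z)" using nw by argo
    then have "L \<le> cmod l * (4 * (C * norm z))" unfolding L_def by (intro mult_left_mono) auto
    also have "\<dots> \<le> norm z / 8" using mult_right_mono[OF l, of "norm z"] by (simp add: mult_ac)
    finally have "norm (z - T x) \<le> norm z / 8" using Txz by (simp add: norm_minus_commute)
    then show ?thesis using xM by auto
  qed
qed

text \<open>Both finiteness claims reduce to colourings by points of finite-dimensional spaces
  attached to the shift: its kernel for the kernel of \<open>T\<close>, and a complement of its
  range for the range of \<open>T\<close>.\<close>

lemma kato_fredholm_of_small_shift: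
  fixes T :: "'a::complex_banach \<Rightarrow> 'a"
  assumes T: "bounded_clinear T" and M: "cvec.subspace M" "closed M" and TM: "T ` M \<subseteq> M"
    and kato: "kato_on M T"
  shows "\<exists>e>0. \<forall>l. cmod l < e \<longrightarrow> (\<exists>p q. defects M M (\<lambda>x. T x - l *\<^sub>C x) p q) \<longrightarrow>
    (\<exists>p q. defects M M T p q)"
proof -
  note cl = bounded_clinear_clin[OF T]
  have clTM: "closed (T ` M)" and ker: "\<And>n. kernel_on M T \<subseteq> (T ^^ n) ` M"
    using kato by (auto simp: kato_on_def)
  note sTM = subspace_clin_image[OF cl M(1)]
  obtain C where C: "C > 0" "\<And>z. z \<in> T ` M \<Longrightarrow> \<exists>y\<in>M. T y = z \<and> norm y \<le> C * norm z"
    using open_mapping_bound[OF bounded_clinear_bounded_linear[OF T] csubspace_subspace[OF M(1)] M(2)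
        csubspace_subspace[OF sTM] clTM refl] by blast
  have "\<exists>p q. defects M M T p q"
    if l: "cmod l < 1 / (32 * C)" and d: "defects M M (\<lambda>x. T x - l *\<^sub>C x) p q" for l p q
  proof -
    define S where "S = (\<lambda>x. T x - l *\<^sub>C x)"
    have S: "bounded_clinear S" unfolding S_def by (rule bounded_clinear_shift[OF T])
    note clS = bounded_clinear_clin[OF S]
    have p: "rel_dim {0} (kernel_on M S) p" and q: "rel_dim (S ` M) M q"
      using d by (auto simp: defects_def S_def)
    have lC: "cmod l * C \<le> 1 / 32" using l C(1) by (simp add: field_simps)
    have "\<exists>n. rel_dim {0} (kernel_on M T) n"
    proof -
      let ?B = "kernel_on M T \<inter> cball 0 1"
      have "\<exists>v. v \<in> kernel_on M S \<and> norm (u - v) \<le> 1 / 16" if u: "u \<in> ?B" for u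
      proof -
        obtain v where v: "v \<in> kernel_on M S" "norm (u - v) \<le> 2 * (cmod l * C) * norm u"
          using kato_kernel_lift[OF T M TM ker C _, of l u] lC u by (auto simp: S_def)
        have "2 * (cmod l * C) * norm u \<le> (1 / 16) * 1"
          using lC C(1) u by (intro mult_mono) auto
        then show ?thesis using v by auto
      qed
      then obtain h where h: "\<And>u. u \<in> ?B \<Longrightarrow> h u \<in> kernel_on M S \<and> norm (u - h u) \<le> 1 / 16"
        by metis
      have hb: "h u \<in> kernel_on M S \<and> norm (h u) \<le> 2" if "u \<in> ?B" for u
        using h[OF that] norm_triangle_sub[of "h u" u] that by (simp add: norm_minus_commute)
      obtain g :: "'a \<Rightarrow> 'a" where g: "finite (g ` ?B)"
        "\<And>y y'. y \<in> ?B \<Longrightarrow> y' \<in> ?B \<Longrightarrow> g y = g y' \<Longrightarrow> norm (h y - h y') < 1 / 4"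
        using finite_dim_colouring[OF p, of "1 / 4" ?B h 2] hb by auto
      show ?thesis
      \<comment> \<open>Here the smaller subspace is zero. Equal colours give distance at most
        \<open>1/16 + 1/4 + 1/16\<close>, below the required \<open>1/2\<close>.\<close>
      proof (rule finite_codim_of_colouring[OF _ _ subspace_kernel_on[OF cl M(1)] _ g(1)])
        fix y y' assume y: "y \<in> ?B" "y' \<in> ?B" "g y = g y'"
        have "norm (y - y') = norm ((y - h y) + (h y - h y') - (y' - h y'))" by simp
        then have "norm (y - y') \<le> norm (y - h y) + norm (h y - h y') + norm (y' - h y')"
          using norm_triangle_ineq[of "y - h y" "h y - h y'"]
            norm_triangle_ineq4[of "(y - h y) + (h y - h y')" "y' - h y'"] by linarith
        then have "norm (y - y') \<le> 1 / 2" using h[OF y(1)] h[OF y(2)] g(2)[OF y] by simp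
        then show "\<exists>r\<in>{0}. norm (y - y' - r) \<le> 1 / 2" by simp
      qed (use cvec.subspace_0[OF subspace_kernel_on[OF cl M(1)]] in auto)
    qed
    moreover have "\<exists>n. rel_dim (T ` M) M n"
    proof -
      obtain F D where F: "rel_dim {0} F q" and D: "D > 0"
        "\<And>z. z \<in> M \<Longrightarrow> \<exists>y\<in>M. \<exists>f\<in>F. z = S y + f \<and> norm y \<le> D * norm z \<and> norm f \<le> D * norm z"
        using finite_codim_bounded_decomposition[OF S M M(2) q] by metis
      let ?B = "M \<inter> cball 0 1"
      obtain a h where ah: "\<And>z. z \<in> M \<Longrightarrow> a z \<in> M \<and> h z \<in> F \<and> z = S (a z) + h z \<and>
          norm (h z) \<le> D * norm z"
        using D(2) by metis
      have hb: "h u \<in> F \<and> norm (h u) \<le> D" if u: "u \<in> ?B" for u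
      proof -
        have "D * norm u \<le> D * 1" using u D(1) by (intro mult_left_mono) auto
        then show ?thesis using ah[of u] u by auto
      qed
      obtain g :: "'a \<Rightarrow> 'a" where g: "finite (g ` ?B)"
        "\<And>y y'. y \<in> ?B \<Longrightarrow> y' \<in> ?B \<Longrightarrow> g y = g y' \<Longrightarrow> norm (h y - h y') < 1 / 8"
        using finite_dim_colouring[OF F, of "1 / 8" ?B h D] hb by auto
      show ?thesis
      proof (rule finite_codim_of_colouring[OF sTM clTM M(1) TM g(1)])
        fix y y' assume y: "y \<in> ?B" "y' \<in> ?B" "g y = g y'"
        define z where "z = S (a y - a y')"
        have "y - y' = (S (a y) + h y) - (S (a y') + h y')"
          using ah[of y] ah[of y'] y by simp
        then have z: "y - y' = z + (h y - h y')" by (simp add: z_def clin_diff[OF clS])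
        have "norm (y - y') \<le> 2" using norm_triangle_ineq4[of y y'] y by simp
        moreover have "z = (y - y') - (h y - h y')" using z by simp
        ultimately have nz: "norm z \<le> 2 + 1 / 8"
          using norm_triangle_ineq4[of "y - y'" "h y - h y'"] g(2)[OF y] by simp
        have "a y - a y' \<in> M" using ah[of y] ah[of y'] y M(1) by (simp add: cvec.subspace_diff)
        then have "z \<in> S ` M" by (simp add: z_def)
        then obtain r where r: "r \<in> T ` M" "norm (z - r) \<le> norm z / 8"
          using kato_range_gap[OF T M TM ker C lC] by (auto simp: S_def)
        have eq: "y - y' - r = (z - r) + (h y - h y')" using z by simp
        have "norm (y - y' - r) \<le> norm (z - r) + norm (h y - h y')"
          unfolding eq by (rule norm_triangle_ineq)
        then have "norm (y - y' - r) \<le> 1 / 2" using r(2) nz g(2)[OF y] by simp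
        then show "\<exists>r\<in>T ` M. norm (y - y' - r) \<le> 1 / 2" using r(1) by blast
      qed
    qed
    ultimately show ?thesis using M(1) by (auto simp: defects_def)
  qed
  then show ?thesis using C(1) by (intro exI[of _ "1 / (32 * C)"]) auto
qed

section \<open>Kato decomposition of B-Fredholm operators\<close>

lemma range_funpow_antimono:
  fixes T :: "'a \<Rightarrow> 'a"
  assumes "m \<le> n"
  shows "range (T ^^ n) \<subseteq> range (T ^^ m)"
proof -
  have "T ^^ n = (T ^^ m) \<circ> (T ^^ (n - m))" using assms by (simp flip: funpow_add)
  then show ?thesis by auto
qed

lemma funpow_range: "(T ^^ k) ` range (T ^^ n) = range (T ^^ (k + n))"
  by (simp add: funpow_add image_comp)

text \<open>On a closed space the range has finite codimension, hence is closed again, and the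
  restriction to it has the same index; this is repeated \<open>k\<close> times.\<close>

lemma defects_image_funpow:
  fixes T :: "'a::complex_banach \<Rightarrow> 'a"
  assumes T: "bounded_clinear T" and "closed Y" and "defects Y Y T p q"
  shows "closed ((T ^^ k) ` Y) \<and>
    (\<exists>p' q'. defects ((T ^^ k) ` Y) ((T ^^ k) ` Y) T p' q' \<and> p' + q = p + q')"
proof (induction k)
  case 0
  then show ?case using assms by auto
next
  case (Suc k)
  let ?Y = "(T ^^ k) ` Y"
  obtain p' q' where *: "closed ?Y" "defects ?Y ?Y T p' q'" "p' + q = p + q'" using Suc by blast
  have "closed (T ` ?Y)"
    using *(1,2) by (intro closed_image_finite_codim[OF T]) (auto simp: defects_def)
  moreover obtain p'' q'' where "defects (T ` ?Y) (T ` ?Y) T p'' q''" "p'' + q' = p' + q''"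
    using defects_restrict_range[OF bounded_clinear_clin[OF T] *(2)] by blast
  moreover have "(T ^^ Suc k) ` Y = T ` ?Y" by (auto simp: image_image)
  ultimately show ?case using *(3) by fastforce
qed

text \<open>The spaces \<open>N(T) \<inter> R(T^m)\<close> decrease with \<open>m\<close> and are
  finite-dimensional from \<open>n\<close> on; at an exponent of least dimension they have become
  constant.\<close>

lemma stable_range_funpow:
  fixes T :: "'a::complex_banach \<Rightarrow> 'a"
  assumes T: "bounded_clinear T" and "closed (range (T ^^ n))"
    and "defects (range (T ^^ n)) (range (T ^^ n)) T p q"
  obtains d p' q' where "d \<ge> 1" "closed (range (T ^^ d))"
    "defects (range (T ^^ d)) (range (T ^^ d)) T p' q'" "p' + q = p + q'"
    "\<And>m. kernel_on (range (T ^^ d)) T \<subseteq> range (T ^^ m)"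
proof -
  define K where "K m = kernel_on (range (T ^^ m)) T" for m
  define a where "a m = (THE k. rel_dim {0} (K m) k)" for m
  have step: "closed (range (T ^^ m)) \<and>
      (\<exists>p' q'. defects (range (T ^^ m)) (range (T ^^ m)) T p' q' \<and> p' + q = p + q')" if "n \<le> m" for m
    using defects_image_funpow[OF assms, of "m - n"] that by (simp add: funpow_range)
  have a: "rel_dim {0} (K m) (a m)" if m: "n \<le> m" for m
  proof -
    obtain k where k: "rel_dim {0} (K m) k" using step[OF m] by (auto simp: defects_def K_def)
    then have "a m = k" unfolding a_def by (rule the_equality) (rule rel_dim_unique[OF _ k])
    then show ?thesis using k by simp
  qed
  \<comment> \<open>The minimum is taken from \<open>Suc n\<close> on to ensure
    \<open>d \<ge> 1\<close>, so that the kernel of \<open>T\<close> lies in that of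
    \<open>T^d\<close>.\<close>
  obtain d where d: "Suc n \<le> d" "\<And>m. Suc n \<le> m \<Longrightarrow> a d \<le> a m"
    using ex_has_least_nat[of "\<lambda>m. Suc n \<le> m" "Suc n" a] by auto
  have "K d \<subseteq> range (T ^^ m)" for m
  proof (cases "d \<le> m")
    case True
    have sub: "K m \<subseteq> K d" using range_funpow_antimono[OF True, of T] by (auto simp: K_def kernel_on_def)
    have am: "rel_dim {0} (K m) (a m)" and ad: "rel_dim {0} (K d) (a d)" using a d(1) True by auto
    obtain i j where ij: "rel_dim {0} (K m) i" "rel_dim (K m) (K d) j" "i + j = a d"
      using rel_dim_split[OF ad rel_dim_subspace_upper[OF am] _ sub] rel_dim_subset[OF am] by blast
    have "i = a m" using rel_dim_unique[OF ij(1) am] .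
    moreover have "a d \<le> a m" using d True by (meson order_trans)
    ultimately have "j = 0" using ij(3) by simp
    then have "K d = K m" using ij(2) by (simp add: rel_dim_0_iff)
    then show ?thesis by (auto simp: K_def kernel_on_def)
  next
    case False
    then show ?thesis using range_funpow_antimono[of m d T] by (auto simp: K_def kernel_on_def)
  qed
  moreover have "n \<le> d" "d \<ge> 1" using d by auto
  ultimately show ?thesis using step[of d] that[of d] unfolding K_def by blast
qed

text \<open>The exponent \<open>d\<close> serves both as the length of the Jordan chains and as the
  power with range \<open>Y\<close>. Thus \<open>T^d\<close> kills \<open>N\<close> and maps
  \<open>M\<close> onto \<open>Y\<close>. The kernel of \<open>T\<close> on \<open>M\<close> is
  \<open>E\<close>, and \<open>G\<close> is a complement of \<open>T M\<close> in \<open>M\<close>,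
  which gives the same numbers \<open>r\<close> and \<open>s\<close>.\<close>

lemma kato_decomposition:
  fixes T :: "'a::complex_banach \<Rightarrow> 'a"
  assumes T: "bounded_clinear T" and d: "d \<ge> 1" and Y: "Y = range (T ^^ d)" and clY: "closed Y"
    and def: "defects Y Y T r s" and stab: "\<And>m. kernel_on Y T \<subseteq> range (T ^^ m)"
  shows "\<exists>M N. (M, N) \<in> Red T \<and> kato_on M T \<and> nilpotent_on N T \<and> defects M M T r s"
proof -
  note cl = bounded_clinear_clin[OF T]
  note clp = clin_funpow[OF cl]
  have sY: "cvec.subspace Y" and r: "rel_dim {0} (kernel_on Y T) r" and s: "rel_dim (T ` Y) Y s"
    using def by (auto simp: defects_def)
  have TY: "T ` Y \<subseteq> Y" by (rule rel_dim_subset[OF s])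
  have sTY: "cvec.subspace (T ` Y)" by (rule rel_dim_subspace_lower[OF s])
  define E where "E = kernel_on Y T"
  have bp: "bounded_linear (T ^^ n)" for n
    by (induction n) (auto simp: comp_def id_def intro: bounded_linear_ident
        bounded_linear_compose[OF bounded_clinear_bounded_linear[OF T]])
  have dY: "(T ^^ d) x \<in> Y" for x unfolding Y by blast
  have kY: "(T ^^ k) x \<in> Y" if "x \<in> Y" for x k using funpow_invariant[OF TY that] .
  have EY: "E \<subseteq> (T ^^ k) ` Y" for k
    unfolding E_def Y funpow_range using stab[of "k + d"] Y by simp
  \<comment> \<open>Stability passes from \<open>E\<close> to the kernels of powers: if
    \<open>T y = T^(j+1) w\<close>, then \<open>y - T^j w\<close> is in \<open>E\<close> and so in
    \<open>T^j Y\<close>.\<close>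
  have kerk: "y \<in> (T ^^ j) ` Y" if "y \<in> Y" "(T ^^ k) y = 0" for y j k
    using that
  proof (induction k arbitrary: y j)
    case 0
    then show ?case
      using cvec.subspace_0[OF subspace_clin_image[OF clp sY]] by simp
  next
    case (Suc k)
    have "T y \<in> Y" using Suc.prems TY by auto
    moreover have "(T ^^ k) (T y) = 0" using Suc.prems by (simp add: funpow_swap1)
    ultimately have "T y \<in> (T ^^ Suc j) ` Y" by (rule Suc.IH)
    then obtain w where w: "w \<in> Y" "T y = T ((T ^^ j) w)" by auto
    then have "y - (T ^^ j) w \<in> E"
      using Suc.prems sY kY by (simp add: E_def kernel_on_def clin_diff[OF cl] cvec.subspace_diff)
    then have "y - (T ^^ j) w \<in> (T ^^ j) ` Y" using EY by blast
    then have "(y - (T ^^ j) w) + (T ^^ j) w \<in> (T ^^ j) ` Y"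
      using w(1) by (intro cvec.subspace_add subspace_clin_image[OF clp sY]) auto
    then show ?case by simp
  qed

  \<comment> \<open>The nilpotent summand \<open>N\<close>\<close>
  obtain P where P: "bounded_clinear P" "range P \<subseteq> E" "\<forall>x\<in>E. P x = x"
    using finite_dim_projection[OF r] by (auto simp: E_def)
  note clP = bounded_clinear_clin[OF P(1)]
  \<comment> \<open>The pairing \<open>(x, j) \<mapsto> P (T\<^sup>j x)\<close> is triangular on \<open>N(T\<^sup>d) \<inter> Y\<close>, so its null space is a complement.\<close>
  define N where "N = {x. (T ^^ d) x = 0 \<and> (\<forall>j<d. P ((T ^^ j) x) = 0)}"
  have sN: "cvec.subspace N"
    unfolding N_def
    by (rule cvec.subspaceI) (auto simp: clin_0[OF clp] clin_0[OF clP] clin_add[OF clp]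
        clin_add[OF clP] clin_scale[OF clp] clin_scale[OF clP])
  have clN: "closed N"
  proof -
    have "N = (T ^^ d) -` {0} \<inter> (\<Inter>j\<in>{..<d}. (\<lambda>x. P ((T ^^ j) x)) -` {0})"
      by (auto simp: N_def)
    moreover have "closed ((T ^^ d) -` {0})"
      by (intro continuous_closed_vimage linear_continuous_at bp) auto
    moreover have "closed ((\<lambda>x. P ((T ^^ j) x)) -` {0})" for j
      by (intro continuous_closed_vimage linear_continuous_at
          bounded_linear_compose[OF bounded_clinear_bounded_linear[OF P(1)] bp]) auto
    ultimately show ?thesis by (auto intro!: closed_Int closed_INT)
  qed
  have TN: "T ` N \<subseteq> N"
  proof safe
    fix x assume x: "x \<in> N"
    have "(T ^^ d) (T x) = T ((T ^^ d) x)" by (simp add: funpow_swap1)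
    then have 1: "(T ^^ d) (T x) = 0" using x by (simp add: N_def clin_0[OF cl])
    \<comment> \<open>Applying \<open>T\<close> shifts the conditions from \<open>j\<close> to
      \<open>j + 1\<close>; the one that falls off the end, at \<open>d\<close>, is covered by
      \<open>T^d x = 0\<close>.\<close>
    have "P ((T ^^ j) (T x)) = 0" if "j < d" for j
    proof (cases "Suc j = d")
      case True
      have "(T ^^ j) (T x) = (T ^^ d) x" using True by (simp add: funpow_swap1 flip: True)
      then show ?thesis using x by (simp add: N_def clin_0[OF clP])
    next
      case False
      have "(T ^^ j) (T x) = (T ^^ Suc j) x" by (simp add: funpow_swap1)
      then show ?thesis using x False that unfolding N_def by (metis (mono_tags, lifting) Suc_lessI mem_Collect_eq)
    qed
    with 1 show "T x \<in> N" by (simp add: N_def)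
  qed
  \<comment> \<open>Descent on the power: once \<open>T^(i+1) x = 0\<close>, the vector
    \<open>T^i x\<close> lies in \<open>E\<close>, where \<open>P\<close> is the identity, and the
    condition defining \<open>N\<close> makes it zero.\<close>
  have YN: "x = 0" if x: "x \<in> Y" "x \<in> N" for x
  proof -
    have "(T ^^ (d - k)) x = 0" if "k \<le> d" for k
      using that
    proof (induction k)
      case 0
      then show ?case using x by (simp add: N_def)
    next
      case (Suc k)
      let ?j = "d - Suc k"
      have "d - k = Suc ?j" using Suc.prems by simp
      then have "T ((T ^^ ?j) x) = 0" using Suc by simp
      then have "(T ^^ ?j) x \<in> E" using kY[OF x(1)] by (simp add: E_def kernel_on_def)
      then have "P ((T ^^ ?j) x) = (T ^^ ?j) x" using P(3) by blast
      moreover have "P ((T ^^ ?j) x) = 0" using x(2) Suc.prems by (simp add: N_def)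
      ultimately show ?case by simp
    qed
    from this[of d] show ?thesis by simp
  qed
  \<comment> \<open>The values \<open>P (T^j x)\<close> are removed from \<open>j = d - 1\<close>
    downwards. The offending vector of \<open>E\<close> is \<open>T^i v\<close> with
    \<open>v\<close> in \<open>Y\<close>; since \<open>T^j v = 0\<close> for \<open>j > i\<close>,
    the conditions already met are not disturbed.\<close>
  have kerd: "\<exists>w\<in>Y. (T ^^ d) w = 0 \<and> x - w \<in> N" if x: "(T ^^ d) x = 0" for x
  proof -
    have "\<exists>w\<in>Y. (T ^^ d) w = 0 \<and> (\<forall>j. d - k \<le> j \<and> j < d \<longrightarrow> P ((T ^^ j) (x - w)) = 0)" if "k \<le> d" for k
      using that
    proof (induction k)
      case 0
      then show ?case using cvec.subspace_0[OF sY] clin_0[OF clp] by (intro bexI[of _ 0]) auto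
    next
      case (Suc k)
      then obtain w where w: "w \<in> Y" "(T ^^ d) w = 0"
        "\<And>j. d - k \<le> j \<Longrightarrow> j < d \<Longrightarrow> P ((T ^^ j) (x - w)) = 0" by auto
      define i where "i = d - Suc k"
      have i: "Suc i = d - k" "i < d" using Suc.prems by (auto simp: i_def)
      define u where "u = P ((T ^^ i) (x - w))"
      have u: "u \<in> E" using P(2) by (auto simp: u_def)
      then obtain v where v: "v \<in> Y" "u = (T ^^ i) v" using EY by blast
      have Tv: "(T ^^ j) v = 0" if j: "Suc i \<le> j" for j
      proof -
        have "j = (j - Suc i) + Suc i" using j by simp
        then have "(T ^^ j) v = (T ^^ (j - Suc i)) ((T ^^ Suc i) v)" by (metis comp_apply funpow_add)
        also have "(T ^^ Suc i) v = 0" using u v(2) by (simp add: E_def kernel_on_def)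
        finally show ?thesis by (simp add: clin_0[OF clp])
      qed
      have "w + v \<in> Y" using w v sY by (auto intro: cvec.subspace_add)
      moreover have "(T ^^ d) (w + v) = 0" using w Tv[of d] i by (simp add: clin_add[OF clp])
      moreover have "P ((T ^^ j) (x - (w + v))) = 0" if j: "i \<le> j" "j < d" for j
      proof -
        have eq: "(T ^^ j) (x - (w + v)) = (T ^^ j) (x - w) - (T ^^ j) v"
          by (simp add: clin_diff[OF clp] clin_add[OF clp])
        show ?thesis
        proof (cases "j = i")
          case True
          have "P u = u" using P(3) u by blast
          then show ?thesis unfolding eq using True v(2) by (simp add: clin_diff[OF clP] u_def)
        next
          case False
          then show ?thesis unfolding eq using j Tv[of j] w(3)[of j] i by simp
        qed
      qed
      ultimately show ?case unfolding i_def by blast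
    qed
    from this[of d] obtain w where "w \<in> Y" "(T ^^ d) w = 0" "\<forall>j<d. P ((T ^^ j) (x - w)) = 0" by auto
    then show ?thesis using x by (intro bexI[of _ w]) (auto simp: N_def clin_diff[OF clp])
  qed

  \<comment> \<open>The Kato summand \<open>M\<close>\<close>
  obtain G where G0: "rel_dim {0} G s \<and> (\<forall>g\<in>G. (T ^^ d) g \<in> T ` Y \<longrightarrow> g = 0) \<and>
      Y = {a + (T ^^ d) g |a g. a \<in> T ` Y \<and> g \<in> G}"
    using rel_dim_lift[OF clp[of d] s eq_refl[OF Y]] by (rule exE)
  then have G: "rel_dim {0} G s" "\<And>g. g \<in> G \<Longrightarrow> (T ^^ d) g \<in> T ` Y \<Longrightarrow> g = 0"
    and YG: "Y = {a + (T ^^ d) g |a g. a \<in> T ` Y \<and> g \<in> G}" by (blast, blast, elim conjE)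
  have sG: "cvec.subspace G" by (rule rel_dim_subspace_upper[OF G(1)])
  \<comment> \<open>\<open>U d = Y + G + T G + \<dots> + T\<^sup>d\<^sup>-\<^sup>1 G\<close> will be \<open>M\<close>, where \<open>T\<^sup>d\<close> maps \<open>G\<close> onto a complement of \<open>T Y\<close> in \<open>Y\<close>.\<close>
  define U where "U = rec_nat Y (\<lambda>k U. cvec.span (U \<union> (T ^^ k) ` G))"
  have U0: "U 0 = Y" and US: "U (Suc k) = cvec.span (U k \<union> (T ^^ k) ` G)" for k
    by (simp_all add: U_def)
  have sU: "cvec.subspace (U k)" for k by (cases k) (auto simp: U0 US sY)
  have USE: "U (Suc k) = {u + (T ^^ k) g |u g. u \<in> U k \<and> g \<in> G}" for k
    unfolding US sum_eq_span_Un[OF sU subspace_clin_image[OF clp sG], symmetric] by auto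
  have Umono: "U k \<subseteq> U (Suc k)" for k unfolding US by (auto intro: cvec.span_base)
  have Ule: "U k \<subseteq> U m" if "k \<le> m" for k m using that Umono by (rule lift_Suc_mono_le[rotated])
  have clU: "closed (U k)" for k
  proof (induction k)
    case 0
    then show ?case using clY by (simp add: U0)
  next
    case (Suc k)
    obtain B where B: "finite B" "G = cvec.span B" using rel_dim_basis[OF G(1)] by auto
    have "(T ^^ k) ` G = cvec.span ((T ^^ k) ` B)"
      unfolding B(2)
    proof
      show "cvec.span ((T ^^ k) ` B) \<subseteq> (T ^^ k) ` cvec.span B"
        by (intro cvec.span_minimal subspace_clin_image[OF clp]) (auto intro: cvec.span_base)
      show "(T ^^ k) ` cvec.span B \<subseteq> cvec.span ((T ^^ k) ` B)"
      proof safe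
        fix x assume "x \<in> cvec.span B"
        then show "(T ^^ k) x \<in> cvec.span ((T ^^ k) ` B)"
          by (induction rule: cvec.span_induct_alt)
            (auto simp: clin_0[OF clp] clin_add[OF clp] clin_scale[OF clp]
              intro: cvec.span_zero cvec.span_add cvec.span_scale cvec.span_base)
      qed
    qed
    then have "U (Suc k) = cvec.span (U k \<union> (T ^^ k) ` B)" unfolding US by (simp add: span_Un_span)
    then obtain n where "rel_dim (U k) (U (Suc k)) n"
      using rel_dim_span_finite[OF finite_imageI[OF B(1)] sU] by metis
    then show ?case using Suc by (rule closed_rel_dim)
  qed
  define M where "M = U d"
  have sM: "cvec.subspace M" and clM: "closed M" by (auto simp: M_def sU clU)
  have YM: "Y \<subseteq> M" unfolding M_def using Ule[of 0 d] U0 by simp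
  have TkG: "(T ^^ k) g \<in> M" if "g \<in> G" for k g
  proof (cases "k < d")
    case True
    have "(T ^^ k) g \<in> U (Suc k)" unfolding US using that by (auto intro: cvec.span_base)
    then show ?thesis using Ule[of "Suc k" d] True unfolding M_def by auto
  next
    case False
    then have "k = d + (k - d)" by simp
    then have "(T ^^ k) g = (T ^^ d) ((T ^^ (k - d)) g)" by (metis comp_apply funpow_add)
    then show ?thesis using dY YM by auto
  qed
  have Uind: "U k \<subseteq> V" if "cvec.subspace V" "Y \<subseteq> V" "\<And>j g. g \<in> G \<Longrightarrow> j < k \<Longrightarrow> (T ^^ j) g \<in> V" for k V
    using that(3)
  proof (induction k)
    case 0
    then show ?case using that(2) by (simp add: U0)
  next
    case (Suc k)
    then show ?case unfolding US using that(1) by (intro cvec.span_minimal) auto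
  qed
  have TM: "T ` M \<subseteq> M"
  proof -
    have "M \<subseteq> T -` M"
      unfolding M_def
    proof (rule Uind[of "T -` U d" d])
      show "cvec.subspace (T -` U d)"
        using sU[of d] by (auto simp: cvec.subspace_def clin_0[OF cl] clin_add[OF cl] clin_scale[OF cl])
      show "Y \<subseteq> T -` U d" using TY YM by (auto simp: M_def)
      fix j g assume "g \<in> G"
      then show "(T ^^ j) g \<in> T -` U d" using TkG[of g "Suc j"] by (simp add: M_def)
    qed
    then show ?thesis by auto
  qed
  have MN: "x = 0" if x: "x \<in> M" "x \<in> N" for x
  proof -
    \<comment> \<open>Independence of the pieces \<open>T^j G\<close> modulo \<open>Y\<close>,
      peeled off from the top. For \<open>u = v + T^k g\<close> the induction hypothesis puts
      \<open>v\<close> into \<open>Y\<close>; then \<open>kerk\<close> gives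
      \<open>T^d g \<in> T Y\<close>, so \<open>g = 0\<close>. Vectors of \<open>N\<close> satisfy
      the premise with \<open>k = d\<close>.\<close>
    have *: "u \<in> Y" if "k \<le> d" "u \<in> U k" "(T ^^ d) u \<in> (T ^^ k) ` Y" for k u
      using that
    proof (induction k arbitrary: u)
      case 0
      then show ?case by (simp add: U0)
    next
      case (Suc k)
      obtain v g where v: "u = v + (T ^^ k) g" "v \<in> U k" "g \<in> G" using Suc.prems USE by blast
      obtain y where y: "y \<in> Y" "(T ^^ d) u = (T ^^ Suc k) y" using Suc.prems by blast
      have c: "(T ^^ d) ((T ^^ k) x) = (T ^^ k) ((T ^^ d) x)" for x
        by (metis add.commute comp_apply funpow_add)
      have "(T ^^ d) v = (T ^^ k) (T y - (T ^^ d) g)"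
        using y(2) v(1) by (simp add: clin_add[OF clp] clin_diff[OF clp] c funpow_swap1 algebra_simps)
      moreover have "T y - (T ^^ d) g \<in> Y" using y(1) TY dY sY by (intro cvec.subspace_diff) auto
      ultimately have vY: "v \<in> Y" using Suc.IH[OF _ v(2)] Suc.prems(1) by auto
      have "d = Suc k + (d - Suc k)" using Suc.prems(1) by simp
      then have "(T ^^ d) v = (T ^^ Suc k) ((T ^^ (d - Suc k)) v)" by (metis comp_apply funpow_add)
      then have "(T ^^ d) v = (T ^^ k) (T ((T ^^ (d - Suc k)) v))" by (simp add: funpow_swap1)
      then have "(T ^^ k) (T y - T ((T ^^ (d - Suc k)) v) - (T ^^ d) g) = 0"
        using \<open>(T ^^ d) v = (T ^^ k) (T y - (T ^^ d) g)\<close>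
        by (simp add: clin_diff[OF clp] clin_add[OF clp] algebra_simps)
      moreover have ty: "T y - T ((T ^^ (d - Suc k)) v) \<in> T ` Y"
        using y(1) kY[OF vY] sTY by (intro cvec.subspace_diff) auto
      then have "T y - T ((T ^^ (d - Suc k)) v) - (T ^^ d) g \<in> Y"
        by (intro cvec.subspace_diff[OF sY] subsetD[OF TY] dY)
      ultimately have "T y - T ((T ^^ (d - Suc k)) v) - (T ^^ d) g \<in> (T ^^ 1) ` Y" by (rule kerk[rotated])
      then have "T y - T ((T ^^ (d - Suc k)) v) - (T ^^ d) g \<in> T ` Y" by simp
      then have "T y - T ((T ^^ (d - Suc k)) v) - (T y - T ((T ^^ (d - Suc k)) v) - (T ^^ d) g) \<in> T ` Y"
        by (rule cvec.subspace_diff[OF sTY ty])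
      moreover have "a - (a - b) = b" for a b :: 'a by simp
      ultimately have "g = 0" using G(2)[OF v(3)] by (simp only:)
      then show ?case using vY v(1) by (simp add: clin_0[OF clp])
    qed
    have "(T ^^ d) x = 0" using x by (simp add: N_def)
    then have "x \<in> Y"
      using *[of d x] x(1) cvec.subspace_0[OF subspace_clin_image[OF clp sY]] by (simp add: M_def)
    then show ?thesis using YN x by blast
  qed
  have sumMN: "\<exists>m\<in>M. \<exists>n\<in>N. x = m + n" for x
  proof -
    \<comment> \<open>Subtracting \<open>T^k g\<close> removes the component of \<open>y\<close>
      outside \<open>T Y\<close> and pushes \<open>T^d (x - u)\<close> one power deeper. After
      \<open>d\<close> rounds it equals \<open>T^d y\<close>, so \<open>x - u - y\<close> is in the
      kernel of \<open>T^d\<close>, which \<open>kerd\<close> splits.\<close>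
    have "\<exists>u\<in>U k. (T ^^ d) (x - u) \<in> (T ^^ k) ` Y" if "k \<le> d" for k
      using that
    proof (induction k)
      case 0
      then show ?case using dY cvec.subspace_0[OF sY] by (intro bexI[of _ 0]) (auto simp: U0)
    next
      case (Suc k)
      then obtain u y where u: "u \<in> U k" "y \<in> Y" "(T ^^ d) (x - u) = (T ^^ k) y" by auto
      then obtain a g where a: "a \<in> Y" "g \<in> G" "y = T a + (T ^^ d) g" using YG by blast
      have c: "(T ^^ d) ((T ^^ k) x) = (T ^^ k) ((T ^^ d) x)" for x
        by (metis add.commute comp_apply funpow_add)
      have "(T ^^ d) (x - (u + (T ^^ k) g)) = (T ^^ d) (x - u) - (T ^^ k) ((T ^^ d) g)"
        by (simp add: clin_diff[OF clp] clin_add[OF clp] c)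
      also have "\<dots> = (T ^^ Suc k) a" unfolding u(3) a(3) by (simp add: clin_add[OF clp] funpow_swap1)
      finally show ?case using USE u(1) a(1,2) by blast
    qed
    from this[of d] obtain u y where u: "u \<in> M" "y \<in> Y" "(T ^^ d) (x - u) = (T ^^ d) y"
      by (auto simp: M_def)
    then have "(T ^^ d) (x - u - y) = 0" by (simp add: clin_diff[OF clp])
    then obtain w where w: "w \<in> Y" "x - u - y - w \<in> N" using kerd by blast
    have "u + y + w \<in> M" using u w YM sM by (auto intro!: cvec.subspace_add)
    then show ?thesis using w(2) by (intro bexI[of _ "u + y + w"] bexI[of _ "x - u - y - w"]) auto
  qed
  have ds: "direct_sum UNIV M N"
    unfolding direct_sum_def
    using sM sN MN sumMN cvec.subspace_0[OF sM] cvec.subspace_0[OF sN] by blast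
  have Red: "(M, N) \<in> Red T" using clM clN TM TN ds by (simp add: Red_def)

  \<comment> \<open>Kernel, range and index of \<open>T\<close> on \<open>M\<close>\<close>
  have TdM: "(T ^^ d) ` M = Y"
  proof
    show "(T ^^ d) ` M \<subseteq> Y" using dY by auto
    show "Y \<subseteq> (T ^^ d) ` M"
    proof
      fix y assume "y \<in> Y"
      then obtain x where x: "y = (T ^^ d) x" unfolding Y by auto
      obtain m n where "m \<in> M" "n \<in> N" "x = m + n" using sumMN by blast
      then show "y \<in> (T ^^ d) ` M" unfolding x by (auto simp: clin_add[OF clp] N_def)
    qed
  qed
  have kerM: "kernel_on M T = E"
  proof
    show "E \<subseteq> kernel_on M T" using YM by (auto simp: E_def kernel_on_def)
    show "kernel_on M T \<subseteq> E"
    proof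
      fix x assume x: "x \<in> kernel_on M T"
      have "(T ^^ d) x = (T ^^ (d - 1)) (T x)" using d by (cases d) (auto simp: funpow_swap1)
      then have "(T ^^ d) x = 0" using x by (simp add: kernel_on_def clin_0[OF clp])
      then obtain w where w: "w \<in> Y" "x - w \<in> N" using kerd by blast
      have "x - w \<in> M" using x w(1) YM sM by (auto simp: kernel_on_def intro: cvec.subspace_diff)
      then have "x = w" using MN w(2) by fastforce
      then show "x \<in> E" using w(1) x by (simp add: E_def kernel_on_def)
    qed
  qed
  have sTM: "cvec.subspace (T ` M)" by (rule subspace_clin_image[OF cl sM])
  have YTM: "Y \<subseteq> T ` M"
  proof -
    have "(T ^^ d) g \<in> T ` M" if "g \<in> G" for g
      using TkG[OF that, of "d - 1"] d by (cases d) auto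
    moreover have "T ` Y \<subseteq> T ` M" using YM by auto
    ultimately have "a + (T ^^ d) g \<in> T ` M" if "a \<in> T ` Y" "g \<in> G" for a g
      using that sTM by (blast intro: cvec.subspace_add)
    then show ?thesis by (subst YG) auto
  qed
  \<comment> \<open>If \<open>g = T m\<close>, then \<open>T^d g = T (T^d m)\<close> lies in
    \<open>T Y\<close>, which excludes every nonzero \<open>g\<close> of \<open>G\<close>.\<close>
  have int: "T ` M \<inter> G = {0}"
  proof -
    have "g = 0" if g: "g \<in> G" "m \<in> M" "g = T m" for g m
    proof -
      have "(T ^^ d) g = T ((T ^^ d) m)" unfolding g(3) by (simp add: funpow_swap1)
      then show ?thesis using G(2)[OF g(1)] dY by auto
    qed
    then show ?thesis using cvec.subspace_0[OF sTM] cvec.subspace_0[OF sG] by auto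
  qed
  have "cvec.span (T ` M \<union> G) = M"
  proof
    show "cvec.span (T ` M \<union> G) \<subseteq> M"
      using TM TkG[of _ 0] sM by (intro cvec.span_minimal) auto
    show "M \<subseteq> cvec.span (T ` M \<union> G)"
      unfolding M_def
    proof (rule Uind)
      show "Y \<subseteq> cvec.span (T ` U d \<union> G)"
        using YTM by (auto simp: M_def intro!: cvec.span_base)
      fix j g assume g: "g \<in> G"
      show "(T ^^ j) g \<in> cvec.span (T ` U d \<union> G)"
      proof (cases j)
        case 0
        then show ?thesis using g by (auto intro: cvec.span_base)
      next
        case (Suc i)
        then have "(T ^^ j) g \<in> T ` M" using TkG[OF g, of i] by simp
        then show ?thesis by (auto simp: M_def intro: cvec.span_base)
      qed
    qed simp
  qed
  then have TMs: "rel_dim (T ` M) M s" using rel_dim_sum[OF G(1) sTM int] by simp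
  have defM: "defects M M T r s" using sM r TMs kerM by (simp add: defects_def E_def)
  have "closed (T ` M)" using closed_image_finite_codim[OF T sM clM clM TMs] .
  moreover have "kernel_on M T \<subseteq> (T ^^ n) ` M" for n
    unfolding kerM using EY[of n] YM by auto
  ultimately have "kato_on M T" by (simp add: kato_on_def)
  moreover have "nilpotent_on N T" unfolding nilpotent_on_def N_def by auto
  ultimately show ?thesis using Red defM by blast
qed

section \<open>The characterization\<close>

lemma fredholm_on_iff_defects:
  assumes "clin S" "cvec.subspace Y"
  shows "fredholm_on Y S \<longleftrightarrow> (\<exists>p q. defects Y Y S p q)"
  using assms
  by (auto simp: fredholm_on_def defects_def fin_cdim_iff[OF subspace_kernel_on]
      fin_ccodim_iff[OF subspace_clin_image])

lemma weyl_on_iff_defects: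
  assumes "clin S" "cvec.subspace Y"
  shows "weyl_on Y S \<longleftrightarrow> (\<exists>p q. defects Y Y S p q \<and> p = q)"
proof -
  have "cvec.dim (kernel_on Y S) = p \<and> ccodim Y (S ` Y) = q" if "defects Y Y S p q" for p q
    using that by (auto simp: defects_def rel_dim_dim rel_dim_ccodim)
  then show ?thesis unfolding weyl_on_def fredholm_on_iff_defects[OF assms] by metis
qed

text \<open>A kernel vector satisfies \<open>T^k x = l^k x\<close>, which vanishes for large
  \<open>k\<close>. Solvability goes by the order at which \<open>y\<close> is killed: a solution
  \<open>x\<close> for \<open>T y\<close> yields the solution \<open>(x - y) / l\<close> for
  \<open>y\<close>.\<close>

lemma nilpotent_shift_bij:
  assumes T: "clin T" and N: "cvec.subspace N" "T ` N \<subseteq> N" and nil: "nilpotent_on N T" and l: "l \<noteq> 0"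
  shows "\<And>x. x \<in> N \<Longrightarrow> T x - l *\<^sub>C x = 0 \<Longrightarrow> x = 0"
    and "\<And>y. y \<in> N \<Longrightarrow> \<exists>x\<in>N. T x - l *\<^sub>C x = y"
proof -
  obtain d where d: "\<And>x. x \<in> N \<Longrightarrow> (T ^^ d) x = 0" using nil by (auto simp: nilpotent_on_def)
  show "x = 0" if x: "x \<in> N" "T x - l *\<^sub>C x = 0" for x
  proof -
    have "(T ^^ k) x = l ^ k *\<^sub>C x" for k
      using x(2) by (induction k) (auto simp: clin_scale[OF T] mult.commute)
    then show ?thesis using d[OF x(1)] l by simp
  qed
  have "\<exists>x\<in>N. T x - l *\<^sub>C x = y" if "y \<in> N" "(T ^^ k) y = 0" for k y
    using that
  proof (induction k arbitrary: y)
    case 0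
    then show ?case using cvec.subspace_0[OF N(1)] by (intro bexI[of _ 0]) (auto simp: clin_0[OF T])
  next
    case (Suc k)
    have "T y \<in> N" "(T ^^ k) (T y) = 0" using Suc.prems N(2) by (auto simp: funpow_swap1)
    then obtain x where x: "x \<in> N" "T x - l *\<^sub>C x = T y" using Suc.IH by blast
    have "T (inverse l *\<^sub>C (x - y)) - l *\<^sub>C (inverse l *\<^sub>C (x - y)) = inverse l *\<^sub>C (T x - l *\<^sub>C x - T y) + y"
      using l by (simp add: clin_diff[OF T] clin_scale[OF T] cvec.scale_right_diff_distrib)
    then have "T (inverse l *\<^sub>C (x - y)) - l *\<^sub>C (inverse l *\<^sub>C (x - y)) = y" using x by simp
    moreover have "inverse l *\<^sub>C (x - y) \<in> N"
      using x Suc.prems N(1) by (auto intro!: cvec.subspace_scale cvec.subspace_diff)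
    ultimately show ?case by blast
  qed
  then show "\<exists>x\<in>N. T x - l *\<^sub>C x = y" if "y \<in> N" for y using d that by blast
qed

lemma Red_sum:
  assumes "(M, N) \<in> Red T"
  shows "\<exists>m n. m \<in> M \<and> n \<in> N \<and> x = m + n"
proof -
  have "UNIV = {m + n |m n. m \<in> M \<and> n \<in> N}" using assms by (simp add: Red_def direct_sum_def)
  then have "x \<in> {m + n |m n. m \<in> M \<and> n \<in> N}" by (metis UNIV_I)
  then show ?thesis by blast
qed

text \<open>The shift is bijective on \<open>N\<close>, so \<open>N\<close> contributes neither to
  the kernel nor to the codimension. The projection \<open>P\<close> onto \<open>M\<close> along
  \<open>N\<close> commutes with the shift; only its linearity is used.\<close>

lemma defects_Red_shift:
  assumes T: "bounded_clinear T" and MN: "(M, N) \<in> Red T" and nil: "nilpotent_on N T" and l: "l \<noteq> 0"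
  shows "defects UNIV UNIV (\<lambda>x. T x - l *\<^sub>C x) p q \<longleftrightarrow> defects M M (\<lambda>x. T x - l *\<^sub>C x) p q"
proof -
  define S where "S = (\<lambda>x. T x - l *\<^sub>C x)"
  have S: "clin S" unfolding S_def by (rule bounded_clinear_clin[OF bounded_clinear_shift[OF T]])
  have TM: "T ` M \<subseteq> M" and TN: "T ` N \<subseteq> N" and sM: "cvec.subspace M" and sN: "cvec.subspace N"
    and int: "M \<inter> N = {0}"
    using MN by (auto simp: Red_def direct_sum_def)
  have SM: "S m \<in> M" if "m \<in> M" for m
    unfolding S_def using that TM sM by (auto intro!: cvec.subspace_diff cvec.subspace_scale)
  have SN: "S n \<in> N" if "n \<in> N" for n
    unfolding S_def using that TN sN by (auto intro!: cvec.subspace_diff cvec.subspace_scale)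
  have inj: "x = 0" if "x \<in> N" "S x = 0" for x
    using nilpotent_shift_bij(1)[OF bounded_clinear_clin[OF T] sN TN nil l] that by (simp add: S_def)
  have surj: "\<exists>x\<in>N. S x = y" if "y \<in> N" for y
    using nilpotent_shift_bij(2)[OF bounded_clinear_clin[OF T] sN TN nil l that] by (simp add: S_def)
  define P where "P x = (SOME m. m \<in> M \<and> x - m \<in> N)" for x
  have P: "P x \<in> M \<and> x - P x \<in> N" for x
  proof -
    obtain m n where "m \<in> M" "n \<in> N" "x = m + n" using Red_sum[OF MN] by blast
    then have "m \<in> M \<and> x - m \<in> N" by simp
    then show ?thesis unfolding P_def by (rule someI)
  qed
  have Pu: "P x = m" if "m \<in> M" "x - m \<in> N" for x m
  proof -
    have "P x - m \<in> M" using P that sM by (auto intro: cvec.subspace_diff)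
    moreover have "(x - m) - (x - P x) \<in> N" using P that(2) by (blast intro: cvec.subspace_diff[OF sN])
    then have "P x - m \<in> N" by simp
    ultimately have "P x - m \<in> M \<inter> N" by (simp only: Int_iff)
    then show ?thesis unfolding int by simp
  qed
  have clP: "clin P"
    unfolding clin_def
  proof (intro conjI allI)
    fix x y
    have "(x - P x) + (y - P y) \<in> N" using P sN by (intro cvec.subspace_add) auto
    then show "P (x + y) = P x + P y"
      using P sM by (intro Pu cvec.subspace_add) (auto simp: algebra_simps)
  next
    fix c x
    have "c *\<^sub>C (x - P x) \<in> N" using P sN by (intro cvec.subspace_scale) auto
    then show "P (c *\<^sub>C x) = c *\<^sub>C P x"
      using P sM by (intro Pu cvec.subspace_scale) (auto simp: cvec.scale_right_diff_distrib)
  qed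
  have PM: "P m = m" if "m \<in> M" for m using Pu[OF that] cvec.subspace_0[OF sN] by simp
  have PS: "P (S x) = S (P x)" for x
  proof (rule Pu)
    show "S (P x) \<in> M" using SM P by blast
    have "S x - S (P x) = S (x - P x)" by (simp add: clin_diff[OF S])
    then show "S x - S (P x) \<in> N" using SN P by simp
  qed
  have ker: "kernel_on UNIV S = kernel_on M S"
  proof
    show "kernel_on UNIV S \<subseteq> kernel_on M S"
    proof
      fix x assume "x \<in> kernel_on UNIV S"
      then have x: "S x = 0" by (simp add: kernel_on_def)
      then have "S (P x) = 0" using PS[of x] by (simp add: clin_0[OF clP])
      then have "S (x - P x) = 0" using x by (simp add: clin_diff[OF S])
      then have "x - P x = 0" using inj P by blast
      then show "x \<in> kernel_on M S" using P[of x] x by (simp add: kernel_on_def)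
    qed
  qed (auto simp: kernel_on_def)
  have up: "rel_dim (range S) UNIV k" if k: "rel_dim (S ` M) M k" for k
  proof -
    obtain G where G: "rel_dim {0} G k" "\<forall>g\<in>G. g \<in> S ` M \<longrightarrow> g = 0"
      "M = {r + g |r g. r \<in> S ` M \<and> g \<in> G}"
      using rel_dim_lift[of "\<lambda>x. x", OF _ k] by (auto simp: clin_def)
    note sG = rel_dim_subspace_upper[OF G(1)]
    have GM: "g \<in> M" if "g \<in> G" for g
    proof -
      have "0 + g \<in> M"
        using G(3) that cvec.subspace_0[OF rel_dim_subspace_lower[OF k]] by blast
      then show ?thesis by simp
    qed
    have sR: "cvec.subspace (range S)" by (rule subspace_clin_image[OF S]) simp
    have "g = 0" if g: "g \<in> G" "g = S x" for g x
    proof -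
      have "g = S (P x)" using PM[OF GM[OF g(1)]] PS[of x] g(2) by simp
      then show ?thesis using G(2) g(1) P by blast
    qed
    then have "range S \<inter> G = {0}" using cvec.subspace_0[OF sR] cvec.subspace_0[OF sG] by auto
    moreover have "cvec.span (range S \<union> G) = UNIV"
    proof -
      have "x \<in> cvec.span (range S \<union> G)" for x
      proof -
        have "P x \<in> M" using P by blast
        then obtain m g where mg: "g \<in> G" "P x = S m + g" using G(3) by blast
        obtain n where n: "S n = x - P x" using surj P by blast
        have "x = S (n + m) + g" using mg n by (simp add: clin_add[OF S] algebra_simps)
        then show ?thesis using mg(1) by (auto intro!: cvec.span_add intro: cvec.span_base)
      qed
      then show ?thesis by auto
    qed
    ultimately show ?thesis using rel_dim_sum[OF G(1) sR] by simp
  qed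
  have "rel_dim (range S) UNIV q \<longleftrightarrow> rel_dim (S ` M) M q"
  proof
    assume q: "rel_dim (range S) UNIV q"
    \<comment> \<open>The image under \<open>P\<close> shows that the codimension in
      \<open>M\<close> is finite; its value is fixed by going back up and comparing with
      \<open>q\<close>.\<close>
    obtain m where m: "rel_dim (P ` range S) (range P) m" using rel_dim_image[OF clP q] by blast
    have PR: "range P = M"
    proof
      show "range P \<subseteq> M" using P by blast
      show "M \<subseteq> range P" using PM by (metis rangeI subsetI)
    qed
    have "P ` range S = S ` range P" by (simp add: image_image PS)
    then have m: "rel_dim (S ` M) M m" using m unfolding PR by simp
    then show "rel_dim (S ` M) M q" using rel_dim_unique[OF up[OF m] q] by simp
  qed (rule up)
  then show ?thesis using sM ker by (simp add: defects_def S_def)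
qed

text \<open>The property \<open>Q\<close> stands for "no condition" in the Fredholm case and for equality in the Weyl case.\<close>

lemma kato_type_characterization:
  fixes T :: "'a::complex_banach \<Rightarrow> 'a"
  assumes T: "bounded_clinear T" and Q: "\<And>p q p' q'. Q p q \<Longrightarrow> p' + q = p + q' \<Longrightarrow> Q p' q'"
  shows "(\<exists>n. closed (range (T ^^ n)) \<and> (\<exists>p q. defects (range (T ^^ n)) (range (T ^^ n)) T p q \<and> Q p q)) \<longleftrightarrow>
    kato_type T \<and> 0 \<notin> interior {z. \<not> (\<exists>p q. defects UNIV UNIV (\<lambda>x. T x - z *\<^sub>C x) p q \<and> Q p q)}"
    (is "?B \<longleftrightarrow> _ \<and> 0 \<notin> interior ?S")
proof (intro iffI conjI; (elim conjE exE)?)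
  fix n p q
  assume n: "closed (range (T ^^ n))" "defects (range (T ^^ n)) (range (T ^^ n)) T p q" and pq: "Q p q"
  obtain d p' q' where d: "d \<ge> 1" "closed (range (T ^^ d))"
    "defects (range (T ^^ d)) (range (T ^^ d)) T p' q'" "p' + q = p + q'"
    "\<And>m. kernel_on (range (T ^^ d)) T \<subseteq> range (T ^^ m)"
    using stable_range_funpow[OF T n] by metis
  obtain M N where MN: "(M, N) \<in> Red T" "kato_on M T" "nilpotent_on N T" "defects M M T p' q'"
    using kato_decomposition[OF T d(1) refl d(2,3,5)] by blast
  show "kato_type T" unfolding kato_type_def using MN by blast
  have "Q p' q'" using Q[OF pq d(4)] .
  have clM: "closed M" using MN by (simp add: Red_def)
  obtain e where e: "e > 0" "\<And>l. cmod l < e \<Longrightarrow>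
      \<exists>p q. defects M M (\<lambda>x. T x - l *\<^sub>C x) p q \<and> p + q' = p' + q"
    using defects_small_perturbation[OF T clM MN(4)] by blast
  show "0 \<notin> interior ?S"
  proof
    assume "0 \<in> interior ?S"
    then obtain r where r: "r > 0" "ball 0 r \<subseteq> ?S" unfolding mem_interior by blast
    define l where "l = complex_of_real (min e r / 2)"
    have l: "cmod l < e" "cmod l < r" "l \<noteq> 0" using e(1) r(1) by (auto simp: l_def)
    obtain p q where pq: "defects M M (\<lambda>x. T x - l *\<^sub>C x) p q" "p + q' = p' + q" using e(2)[OF l(1)] by blast
    have "defects UNIV UNIV (\<lambda>x. T x - l *\<^sub>C x) p q"
      using defects_Red_shift[OF T MN(1,3) l(3)] pq(1) by blast
    moreover have "Q p q" using Q[OF \<open>Q p' q'\<close> pq(2)] .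
    moreover have "l \<in> ?S" using r(2) l(2) by auto
    ultimately show False by blast
  qed
next
  assume kt: "kato_type T" and notin: "0 \<notin> interior ?S"
  obtain M N where MN: "(M, N) \<in> Red T" "kato_on M T" "nilpotent_on N T"
    using kt by (auto simp: kato_type_def)
  have clM: "closed M" and TM: "T ` M \<subseteq> M" and sM: "cvec.subspace M"
    using MN(1) by (auto simp: Red_def direct_sum_def)
  have small: "\<exists>l p q. cmod l < e \<and> defects UNIV UNIV (\<lambda>x. T x - l *\<^sub>C x) p q \<and> Q p q" if "e > 0" for e
  proof -
    have "\<not> ball 0 e \<subseteq> ?S" using notin that unfolding mem_interior by blast
    then show ?thesis by auto
  qed
  show ?B
  \<comment> \<open>A good shift near 0 may be \<open>l = 0\<close> itself, where \<open>N\<close>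
    cannot be dropped; then the exponent 0 is a witness. Otherwise all good shifts are nonzero and
    may be restricted to \<open>M\<close>.\<close>
  proof (cases "\<exists>p q. defects UNIV UNIV T p q \<and> Q p q")
    case True
    then show ?thesis by (intro exI[of _ 0]) simp
  next
    case False
    have small': "\<exists>l p q. cmod l < e \<and> defects M M (\<lambda>x. T x - l *\<^sub>C x) p q \<and> Q p q" if e: "e > 0" for e
    proof -
      obtain l p q where l: "cmod l < e" "defects UNIV UNIV (\<lambda>x. T x - l *\<^sub>C x) p q" "Q p q"
        using small[OF e] by blast
      have "l \<noteq> 0"
      proof
        assume "l = 0"
        with l(2) have "defects UNIV UNIV T p q" by simp
        with False l(3) show False by blast
      qed
      then show ?thesis using l defects_Red_shift[OF T MN(1,3)] by blast
    qed
    obtain p0 q0 where d0: "defects M M T p0 q0"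
      using kato_fredholm_of_small_shift[OF T sM clM TM MN(2)] small' by meson
    obtain e where e: "e > 0" "\<And>l. cmod l < e \<Longrightarrow>
        \<exists>p q. defects M M (\<lambda>x. T x - l *\<^sub>C x) p q \<and> p + q0 = p0 + q"
      using defects_small_perturbation[OF T clM d0] by blast
    obtain l p q where l: "cmod l < e" "defects M M (\<lambda>x. T x - l *\<^sub>C x) p q" "Q p q"
      using small'[OF e(1)] by blast
    \<comment> \<open>Every sufficiently small shift on \<open>M\<close> has the index of
      \<open>T\<close> there, so a single good shift decides \<open>Q\<close> for \<open>T\<close>
      on \<open>M\<close>.\<close>
    have "p + q0 = p0 + q" using e(2)[OF l(1)] defects_unique[OF l(2)] by blast
    then have Q0: "Q p0 q0" using Q[OF l(3), of p0 q0] by simp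
    obtain d where d: "\<And>x. x \<in> N \<Longrightarrow> (T ^^ d) x = 0" using MN(3) by (auto simp: nilpotent_on_def)
    note clp = clin_funpow[OF bounded_clinear_clin[OF T], of d]
    \<comment> \<open>Since \<open>T^d\<close> kills \<open>N\<close>, its range is the image of
      \<open>M\<close>, and the index of \<open>T\<close> on \<open>M\<close> descends to
      it.\<close>
    have "range (T ^^ d) = (T ^^ d) ` M"
    proof
      show "range (T ^^ d) \<subseteq> (T ^^ d) ` M"
      proof safe
        fix x
        obtain m n where "m \<in> M" "n \<in> N" "x = m + n" using Red_sum[OF MN(1)] by blast
        then show "(T ^^ d) x \<in> (T ^^ d) ` M" using d by (auto simp: clin_add[OF clp])
      qed
    qed auto
    then show ?thesis
      using defects_image_funpow[OF T clM d0, of d] Q[OF Q0] by metis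
  qed
qed

theorem mainTheorem6:
  fixes T :: "'a::complex_banach \<Rightarrow> 'a"
  assumes "\<not> fin_cdim (UNIV :: 'a set)"
    and "bounded_clinear T"
  shows "(B_fredholm T \<longleftrightarrow> kato_type T \<and> 0 \<notin> interior (fredholm_spectrum T)) \<and>
         (B_weyl T \<longleftrightarrow> kato_type T \<and> 0 \<notin> interior (weyl_spectrum T))"
proof -
  note cl = bounded_clinear_clin[OF assms(2)]
  have sR: "cvec.subspace (range (T ^^ n))" for n
    by (rule subspace_clin_image[OF clin_funpow[OF cl]]) simp
  have shift: "clin (\<lambda>x. T x - z *\<^sub>C x)" for z
    by (rule bounded_clinear_clin[OF bounded_clinear_shift[OF assms(2)]])
  show ?thesis
    using kato_type_characterization[OF assms(2), of "\<lambda>p q. True"]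
      kato_type_characterization[OF assms(2), of "\<lambda>p q. p = q"]
    unfolding B_fredholm_def B_weyl_def fredholm_spectrum_def weyl_spectrum_def
      fredholm_on_iff_defects[OF cl sR] weyl_on_iff_defects[OF cl sR]
      fredholm_on_iff_defects[OF shift cvec.subspace_UNIV] weyl_on_iff_defects[OF shift cvec.subspace_UNIV]
    by simp
qed

end
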